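(* Let $L\ne\{0,1\}$ be a C-lattice domain in which every element is a join of principal elements, and suppose $L$ has finite character. The following are equivalent: (i) $L$ is sharp; (ii) for every maximal element $m$ of $L$, the localization $L_m$ is isomorphic to $\mathbb{Z}_-$ or to $\mathbb{R}_1$.
   Context: A multiplicative lattice is a complete lattice $(L,\le)$ with bottom $0$ and top $1$ which is also a commutative monoid with identity $1$ such that $a(\bigvee_\alpha b_\alpha)=\bigvee_\alpha(ab_\alpha)$ for all $a,b_\alpha\in L$. For $x,y\in L$, $(y:x)=\bigvee\{a\in L: ax\le y\}$. An element $c$ is compact if $c\le\bigvee S$ implies $c\le\bigvee T$ for some finite $T\subseteq S$. A C-lattice is a multiplicative lattice in which $1$ is compact, the product of two compact elements is compact, and every element is a join of compact elements; $L^*$ denotes its compact elements. A proper element $p\ne1$ is prime if $xy\le p$ implies $x\le p$ or $y\le p$; maximal elements are maximal in $L\setminus\{1\}$; $L$ is a domain if $0$ is prime. An element $x$ is principal if $y\wedge zx=((y:x)\wedge z)x$ and $y\vee(z:x)=((yx\vee z):x)$ for all $y,z\in L$. $L$ is sharp if whenever $a_1a_2\le b$ with $a_1,a_2,b\in L$, there exist $b_1,b_2\in L$ with $a_i\le b_i$ ($i=1,2$) and $b=b_1b_2$. $L$ has finite character if every nonzero element is below only finitely many maximal elements. For $p$ prime and $x\in L$, $x_p=\bigvee\{a\in L^*: as\le x \text{ for some } s\in L^*,\ s\not\le p\}$, and $L_p=\{x_p:x\in L\}$ is a lattice with multiplication $(x,y)\mapsto(xy)_p$ and the induced order. $\mathbb{Z}_-$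 is the set of integers $\le0$ together with $-\infty$, with the usual order and addition as multiplication. $\mathbb{R}_1$ is the set of all intervals $(r,\infty]$ and $[r,\infty]$ with $r\ge0$ real, together with $\{\infty\}$, ordered by inclusion with interval addition as multiplication (isomorphic to the ideal lattice of a valuation domain with value group $\mathbb{R}$). *)

theory Defs
  imports Main "HOL-Library.Extended_Real"
begin

definition mult_lattice :: "('a::complete_lattice \<Rightarrow> 'a \<Rightarrow> 'a) \<Rightarrow> bool" where
  "mult_lattice mult \<longleftrightarrow>
     (\<forall>a b c. mult (mult a b) c = mult a (mult b c)) \<and>
     (\<forall>a b. mult a b = mult b a) \<and>
     (\<forall>a. mult top a = a) \<and>
     (\<forall>a B. mult a (Sup B) = Sup ((\<lambda>b. mult a b) ` B))"

definition ml_colon :: "('a::complete_lattice \<Rightarrow> 'a \<Rightarrow> 'a) \<Rightarrow> 'a \<Rightarrow> 'a \<Rightarrow> 'a" where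
  "ml_colon mult y x = Sup {a. mult a x \<le> y}"

definition ml_compact :: "'a::complete_lattice \<Rightarrow> bool" where
  "ml_compact c \<longleftrightarrow> (\<forall>S. c \<le> Sup S \<longrightarrow> (\<exists>T. T \<subseteq> S \<and> finite T \<and> c \<le> Sup T))"

definition C_lattice :: "('a::complete_lattice \<Rightarrow> 'a \<Rightarrow> 'a) \<Rightarrow> bool" where
  "C_lattice mult \<longleftrightarrow> mult_lattice mult \<and> ml_compact (top::'a) \<and>
     (\<forall>a b. ml_compact a \<and> ml_compact b \<longrightarrow> ml_compact (mult a b)) \<and>
     (\<forall>x::'a. x = Sup {c. ml_compact c \<and> c \<le> x})"

definition ml_prime :: "('a::complete_lattice \<Rightarrow> 'a \<Rightarrow> 'a) \<Rightarrow> 'a \<Rightarrow> bool" where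
  "ml_prime mult p \<longleftrightarrow> p \<noteq> top \<and> (\<forall>x y. mult x y \<le> p \<longrightarrow> x \<le> p \<or> y \<le> p)"

definition ml_maximal :: "'a::complete_lattice \<Rightarrow> bool" where
  "ml_maximal m \<longleftrightarrow> m \<noteq> top \<and> (\<forall>x. m \<le> x \<and> x \<noteq> top \<longrightarrow> x = m)"

definition ml_domain :: "('a::complete_lattice \<Rightarrow> 'a \<Rightarrow> 'a) \<Rightarrow> bool" where
  "ml_domain mult \<longleftrightarrow> ml_prime mult bot"

definition ml_principal :: "('a::complete_lattice \<Rightarrow> 'a \<Rightarrow> 'a) \<Rightarrow> 'a \<Rightarrow> bool" where
  "ml_principal mult x \<longleftrightarrow>
     (\<forall>y z. inf y (mult z x) = mult (inf (ml_colon mult y x) z) x \<and>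
            sup y (ml_colon mult z x) = ml_colon mult (sup (mult y x) z) x)"

definition ml_sharp :: "('a::complete_lattice \<Rightarrow> 'a \<Rightarrow> 'a) \<Rightarrow> bool" where
  "ml_sharp mult \<longleftrightarrow> (\<forall>a1 a2 b. mult a1 a2 \<le> b \<longrightarrow>
     (\<exists>b1 b2. a1 \<le> b1 \<and> a2 \<le> b2 \<and> b = mult b1 b2))"

definition ml_finite_character :: "'a::complete_lattice itself \<Rightarrow> bool" where
  "ml_finite_character _ \<longleftrightarrow> (\<forall>x::'a. x \<noteq> bot \<longrightarrow> finite {m. ml_maximal m \<and> x \<le> m})"

definition ml_loc :: "('a::complete_lattice \<Rightarrow> 'a \<Rightarrow> 'a) \<Rightarrow> 'a \<Rightarrow> 'a \<Rightarrow> 'a" where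
  "ml_loc mult p x = Sup {a. ml_compact a \<and>
       (\<exists>s. ml_compact s \<and> \<not> s \<le> p \<and> mult a s \<le> x)}"

definition loc_carrier :: "('a::complete_lattice \<Rightarrow> 'a \<Rightarrow> 'a) \<Rightarrow> 'a \<Rightarrow> 'a set" where
  "loc_carrier mult p = range (ml_loc mult p)"

definition loc_mult :: "('a::complete_lattice \<Rightarrow> 'a \<Rightarrow> 'a) \<Rightarrow> 'a \<Rightarrow> 'a \<Rightarrow> 'a \<Rightarrow> 'a" where
  "loc_mult mult p x y = ml_loc mult p (mult x y)"

definition mlat_iso ::
  "'a set \<Rightarrow> ('a \<Rightarrow> 'a \<Rightarrow> bool) \<Rightarrow> ('a \<Rightarrow> 'a \<Rightarrow> 'a) \<Rightarrow>
   'b set \<Rightarrow> ('b \<Rightarrow> 'b \<Rightarrow> bool) \<Rightarrow> ('b \<Rightarrow> 'b \<Rightarrow> 'b) \<Rightarrow> bool" where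
  "mlat_iso A leA mulA B leB mulB \<longleftrightarrow>
     (\<exists>f. bij_betw f A B \<and>
          (\<forall>x\<in>A. \<forall>y\<in>A. leA x y \<longleftrightarrow> leB (f x) (f y)) \<and>
          (\<forall>x\<in>A. \<forall>y\<in>A. f (mulA x y) = mulB (f x) (f y)))"

text \<open>Z_-: integers \<le> 0 together with -\<infinity>, usual order, addition as multiplication.\<close>

definition Zminus :: "ereal set" where
  "Zminus = {ereal (real_of_int k) | k. k \<le> 0} \<union> {-\<infinity>}"

text \<open>R_1: intervals (r,\<infinity>] and [r,\<infinity>] (r \<ge> 0 real) and {\<infinity>}, ordered by inclusion,
  interval addition as multiplication.\<close>

definition R1 :: "ereal set set" where
  "R1 = {{x. ereal r < x} | r. r \<ge> 0} \<union> {{x. ereal r \<le> x} | r. r \<ge> 0} \<union> {{\<infinity>}}"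

definition interval_add :: "ereal set \<Rightarrow> ereal set \<Rightarrow> ereal set" where
  "interval_add A B = {a + b | a b. a \<in> A \<and> b \<in> B}"

end

(* Taking b1 = (b : a) in the definition, sharpness amounts to b = (b : a)(b : (b : a)) for all a, b.
   Hence in a sharp L the factors of principal elements are principal, any two nonzero principal
   elements x, y have the form x = x' d, y = y' d with x' and y' comaximal, and after localization at
   a maximal element m the nonzero principal elements form the positive cone of a totally ordered
   group in which bounded infima exist. By Hoelder's argument such a cone is a copy of the natural
   numbers or of the nonnegative reals, and elements of L_m correspond to its upward closed subsets.

   Conversely both model lattices are sharp, and powers of their non-idempotent elements get below
   every nonzero element. The latter makes localizations at different maximal elements independent,
   so that with finite character the local factorizations of b are glued by finite meets. *)

theory Submission
  imports Defs
begin

section \<open>Complete positive cones and real numbers\<close>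

text \<open>\<open>L_m\<close> is never turned into a type: \<open>ml_loc mult m\<close> is handled
  as a closure operator on L that respects products, and statements about \<open>L_m\<close> become
  inequalities \<open>x \<le> j y\<close> in L. This is why the cone is a locale over a carrier, an
  operation and a relation. The main obstacle is completeness: an infimum of localized principal
  elements has no evident reason to be principal. The identity b = (b : g)(b : (b : g)) decides
  this, with g the infimum and b a principal lower bound: g turns out to be a double residual and
  thus a factor of b. It is principal because, locally, a principal element below a join of
  principal elements lies below one of them. Completeness also supplies the Archimedean property,
  which brings the values into the real numbers. Which model occurs depends only on whether the cone
  has a least nonzero element. The order flips on the way: multiplication is addition of values,
  \<open>top\<close> has value 0, and smaller elements have larger values.\<close>

locale complete_cone =
  fixes M :: "'a set" and add :: "'a \<Rightarrow> 'a \<Rightarrow> 'a" (infixl "\<oplus>" 65)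
    and zero :: 'a ("\<zero>") and le :: "'a \<Rightarrow> 'a \<Rightarrow> bool" (infix "\<sqsubseteq>" 50)
  assumes closed: "\<lbrakk>x \<in> M; y \<in> M\<rbrakk> \<Longrightarrow> x \<oplus> y \<in> M"
    and assoc: "\<lbrakk>x \<in> M; y \<in> M; z \<in> M\<rbrakk> \<Longrightarrow> (x \<oplus> y) \<oplus> z = x \<oplus> (y \<oplus> z)"
    and comm: "\<lbrakk>x \<in> M; y \<in> M\<rbrakk> \<Longrightarrow> x \<oplus> y = y \<oplus> x"
    and zero_in: "\<zero> \<in> M"
    and zero_left: "x \<in> M \<Longrightarrow> \<zero> \<oplus> x = x"
    and cancel: "\<lbrakk>x \<in> M; y \<in> M; z \<in> M; x \<oplus> y = x \<oplus> z\<rbrakk> \<Longrightarrow> y = z"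
    and total: "\<lbrakk>x \<in> M; y \<in> M\<rbrakk> \<Longrightarrow> x \<sqsubseteq> y \<or> y \<sqsubseteq> x"
    and antisym: "\<lbrakk>x \<in> M; y \<in> M; x \<sqsubseteq> y; y \<sqsubseteq> x\<rbrakk> \<Longrightarrow> x = y"
    and le_iff: "\<lbrakk>x \<in> M; y \<in> M\<rbrakk> \<Longrightarrow> x \<sqsubseteq> y \<longleftrightarrow> (\<exists>z\<in>M. y = x \<oplus> z)"
    and sup_ex: "\<lbrakk>S \<subseteq> M; S \<noteq> {}; b \<in> M; \<And>s. s \<in> S \<Longrightarrow> s \<sqsubseteq> b\<rbrakk> \<Longrightarrow>
      \<exists>g\<in>M. (\<forall>s\<in>S. s \<sqsubseteq> g) \<and> (\<forall>h\<in>M. (\<forall>s\<in>S. s \<sqsubseteq> h) \<longrightarrow> g \<sqsubseteq> h)"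
begin

section \<open>Multiples and order in the cone\<close>

definition nmul :: "nat \<Rightarrow> 'a \<Rightarrow> 'a" where
  "nmul n x = (((\<oplus>) x) ^^ n) \<zero>"

lemma nmul_0 [simp]: "nmul 0 x = \<zero>"
  and nmul_Suc: "nmul (Suc n) x = x \<oplus> nmul n x"
  by (simp_all add: nmul_def)

lemma zero_right: "x \<in> M \<Longrightarrow> x \<oplus> \<zero> = x"
  using comm zero_in zero_left by metis

lemma nmul_1 [simp]: "x \<in> M \<Longrightarrow> nmul (Suc 0) x = x"
  by (simp add: nmul_Suc zero_right)

lemma nmul_in [simp]: "x \<in> M \<Longrightarrow> nmul n x \<in> M"
  by (induction n) (auto simp: zero_in nmul_Suc closed)

lemma left_comm: "\<lbrakk>x \<in> M; y \<in> M; z \<in> M\<rbrakk> \<Longrightarrow> x \<oplus> (y \<oplus> z) = y \<oplus> (x \<oplus> z)"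
  by (metis assoc comm)

lemma nmul_plus: "x \<in> M \<Longrightarrow> nmul (a + b) x = nmul a x \<oplus> nmul b x"
  by (induction a) (simp_all add: nmul_Suc zero_left assoc)

lemma nmul_mult: "x \<in> M \<Longrightarrow> nmul (a * b) x = nmul a (nmul b x)"
  by (induction a) (simp_all add: nmul_Suc nmul_plus)

lemma nmul_add: "\<lbrakk>x \<in> M; y \<in> M\<rbrakk> \<Longrightarrow> nmul n (x \<oplus> y) = nmul n x \<oplus> nmul n y"
  by (induction n) (simp_all add: nmul_Suc zero_left zero_in assoc closed left_comm)

lemma le_refl: "x \<in> M \<Longrightarrow> x \<sqsubseteq> x"
  using total by blast

lemma le_add: "\<lbrakk>x \<in> M; y \<in> M\<rbrakk> \<Longrightarrow> x \<sqsubseteq> x \<oplus> y"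
  by (subst le_iff) (auto simp: closed)

lemma zero_le: "x \<in> M \<Longrightarrow> \<zero> \<sqsubseteq> x"
  using le_add[of \<zero> x] by (simp add: zero_in zero_left)

lemma le_trans: "\<lbrakk>x \<in> M; y \<in> M; z \<in> M; x \<sqsubseteq> y; y \<sqsubseteq> z\<rbrakk> \<Longrightarrow> x \<sqsubseteq> z"
  by (metis assoc closed le_iff)

lemma add_mono: "\<lbrakk>x \<in> M; y \<in> M; z \<in> M; w \<in> M; x \<sqsubseteq> y; z \<sqsubseteq> w\<rbrakk> \<Longrightarrow> x \<oplus> z \<sqsubseteq> y \<oplus> w"
proof -
  assume *: "x \<in> M" "y \<in> M" "z \<in> M" "w \<in> M" "x \<sqsubseteq> y" "z \<sqsubseteq> w"
  then obtain a b where "a \<in> M" "b \<in> M" "y = x \<oplus> a" "w = z \<oplus> b"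
    by (auto simp: le_iff)
  with * have "y \<oplus> w = (x \<oplus> z) \<oplus> (a \<oplus> b)"
    by (simp add: assoc closed left_comm)
  then show ?thesis using * \<open>a \<in> M\<close> \<open>b \<in> M\<close> by (simp add: le_add closed)
qed

lemma add_le_cancel:
  assumes "x \<in> M" "y \<in> M" "z \<in> M" "x \<oplus> y \<sqsubseteq> x \<oplus> z"
  shows "y \<sqsubseteq> z"
proof -
  obtain w where w: "w \<in> M" "x \<oplus> z = x \<oplus> (y \<oplus> w)"
    using assms le_iff[of "x \<oplus> y" "x \<oplus> z"] by (auto simp: closed assoc)
  then have "z = y \<oplus> w" using assms cancel[of x z "y \<oplus> w"] closed by simp
  then show ?thesis using assms w le_add by simp
qed

lemma add_eq_zero: "\<lbrakk>x \<in> M; y \<in> M; x \<oplus> y = \<zero>\<rbrakk> \<Longrightarrow> x = \<zero>"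
  by (metis antisym le_add zero_in zero_le)

lemma nmul_mono: "\<lbrakk>x \<in> M; y \<in> M; x \<sqsubseteq> y\<rbrakk> \<Longrightarrow> nmul n x \<sqsubseteq> nmul n y"
  by (induction n) (auto simp: nmul_Suc add_mono le_refl zero_in)

lemma nmul_mono_left: "\<lbrakk>x \<in> M; a \<le> b\<rbrakk> \<Longrightarrow> nmul a x \<sqsubseteq> nmul b x"
  by (metis le_add le_add_diff_inverse nmul_in nmul_plus)

lemma nmul_eq_zero: "\<lbrakk>x \<in> M; x \<noteq> \<zero>; nmul n x = \<zero>\<rbrakk> \<Longrightarrow> n = 0"
  by (cases n) (auto simp: nmul_Suc dest: add_eq_zero[OF _ nmul_in])

lemma nmul_le_imp:
  assumes "x \<in> M" "x \<noteq> \<zero>" "nmul a x \<sqsubseteq> nmul b x"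
  shows "a \<le> b"
proof (rule ccontr)
  assume "\<not> a \<le> b"
  then have "nmul a x = nmul b x"
    using assms nmul_mono_left[of x b a] by (intro antisym) auto
  moreover have "nmul a x = nmul b x \<oplus> nmul (a - b) x"
    using \<open>\<not> a \<le> b\<close> assms nmul_plus[of x b "a - b"] by simp
  ultimately have "nmul (a - b) x = \<zero>"
    using assms cancel[of "nmul b x" "nmul (a-b) x" \<zero>] by (simp add: zero_right zero_in)
  then show False using nmul_eq_zero[of x "a - b"] assms \<open>\<not> a \<le> b\<close> by simp
qed

text \<open>If the multiples of \<open>u\<close> were bounded, subtracting \<open>u\<close> from their supremum would give a
  smaller upper bound.\<close>

lemma archimedean:
  assumes u: "u \<in> M" "u \<noteq> \<zero>" and x: "x \<in> M"
  shows "\<exists>n. \<not> nmul n u \<sqsubseteq> x"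
proof (rule ccontr)
  assume "\<not> ?thesis"
  then have "\<exists>g\<in>M. (\<forall>s\<in>range (\<lambda>n. nmul n u). s \<sqsubseteq> g) \<and>
      (\<forall>h\<in>M. (\<forall>s\<in>range (\<lambda>n. nmul n u). s \<sqsubseteq> h) \<longrightarrow> g \<sqsubseteq> h)"
    using u x by (intro sup_ex[where b = x]) auto
  then obtain g where g: "g \<in> M" "\<And>n. nmul n u \<sqsubseteq> g"
    and least: "\<And>h. \<lbrakk>h \<in> M; \<And>n. nmul n u \<sqsubseteq> h\<rbrakk> \<Longrightarrow> g \<sqsubseteq> h"
    by blast
  have "u \<sqsubseteq> g" using g(2)[of 1] u by simp
  then obtain h where h: "h \<in> M" "g = u \<oplus> h" using le_iff u g by blast
  have "nmul n u \<sqsubseteq> h" for n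
    using g(2)[of "Suc n"] h u by (auto simp: nmul_Suc intro: add_le_cancel[of u])
  then have "g \<sqsubseteq> h" using least h by blast
  then have "g = h" using antisym[of g h] g h u le_add[of h u] by (simp add: comm)
  then have "h \<oplus> \<zero> = h \<oplus> u" using h u by (simp add: zero_right comm)
  then show False using cancel[of h \<zero> u] u h by (simp add: zero_in)
qed

section \<open>Hoelder's embedding into the real numbers\<close>

text \<open>Hoelder's ratio of x to u: the admissible fractions form the lower part of a Dedekind
  cut.\<close>

definition val :: "'a \<Rightarrow> 'a \<Rightarrow> real" where
  "val u x = Sup {real n / real k |n k. k > 0 \<and> nmul n u \<sqsubseteq> nmul k x}"

context
  fixes u assumes u: "u \<in> M" "u \<noteq> \<zero>"
begin

lemma floor_ex:
  assumes "x \<in> M"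
  obtains n where "nmul n u \<sqsubseteq> x" "x \<sqsubseteq> nmul (Suc n) u"
proof -
  define n where "n = (LEAST n. \<not> nmul n u \<sqsubseteq> x)"
  have n: "\<not> nmul n u \<sqsubseteq> x" unfolding n_def
    using archimedean[OF u assms] by (rule LeastI_ex)
  have "n \<noteq> 0" using n assms by (metis nmul_0 zero_le)
  then obtain p where p: "n = Suc p" using not0_implies_Suc by blast
  have "nmul p u \<sqsubseteq> x" using not_less_Least[of p "\<lambda>n. \<not> nmul n u \<sqsubseteq> x"] p n_def by simp
  moreover have "x \<sqsubseteq> nmul (Suc p) u" using n p total[of x "nmul n u"] assms u by auto
  ultimately show ?thesis using that by blast
qed

text \<open>The real supremum in \<open>val\<close> is meaningful only for bounded sets. If x is
  below N u, then n u \<sqsubseteq> k x \<sqsubseteq> k N u gives n \<le> k N.\<close>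

lemma val_bdd:
  assumes "x \<in> M"
  shows "bdd_above {real n / real k |n k. k > 0 \<and> nmul n u \<sqsubseteq> nmul k x}"
proof -
  obtain p where p: "x \<sqsubseteq> nmul (Suc p) u" using floor_ex assms by blast
  have "real n / real k \<le> real (Suc p)" if "k > 0" "nmul n u \<sqsubseteq> nmul k x" for n k
  proof -
    have "nmul n u \<sqsubseteq> nmul (k * Suc p) u"
      using that nmul_mono[OF _ _ p, of k] assms u
        le_trans[of "nmul n u" "nmul k x" "nmul k (nmul (Suc p) u)"]
      by (simp add: nmul_mult del: mult_Suc_right)
    then have "n \<le> k * Suc p" using nmul_le_imp u by blast
    then have "real n \<le> real k * real (Suc p)" by (metis of_nat_le_iff of_nat_mult)
    then show ?thesis using that by (simp add: field_simps)
  qed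
  then show ?thesis by (auto intro!: bdd_aboveI[of _ "real (Suc p)"])
qed

lemma val_ge:
  assumes "x \<in> M" "k > 0" "nmul n u \<sqsubseteq> nmul k x"
  shows "real n / real k \<le> val u x"
  unfolding val_def by (rule cSup_upper[OF _ val_bdd]) (use assms in auto)

lemma val_le:
  assumes "x \<in> M" "\<And>n k. \<lbrakk>k > 0; nmul n u \<sqsubseteq> nmul k x\<rbrakk> \<Longrightarrow> real n / real k \<le> r"
  shows "val u x \<le> r"
proof -
  have "nmul 0 u \<sqsubseteq> nmul 1 x" using assms by (simp add: zero_le)
  then have "{real n / real k |n k. k > 0 \<and> nmul n u \<sqsubseteq> nmul k x} \<noteq> {}"
    by (metis (mono_tags, lifting) empty_Collect_eq zero_less_one)
  then show ?thesis unfolding val_def by (rule cSup_least) (use assms in auto)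
qed

lemma val_nonneg: "x \<in> M \<Longrightarrow> 0 \<le> val u x"
  using val_ge[of x 1 0] by (simp add: zero_le)

lemma val_unit: "val u u = 1"
proof (rule order_antisym)
  show "val u u \<le> 1"
    using nmul_le_imp[OF u] by (intro val_le u) (auto simp: field_simps)
  show "1 \<le> val u u" using val_ge[of u 1 1] u by (simp add: le_refl)
qed

text \<open>Lower bounds add after passing to a common denominator. An upper bound cannot be read
  off from one fraction n/k for x \<oplus> y, so it is shown up to e by refining the denominator to
  N k.\<close>

lemma val_add:
  assumes x: "x \<in> M" and y: "y \<in> M"
  shows "val u (x \<oplus> y) = val u x + val u y"
proof (rule order_antisym)
  have xy: "x \<oplus> y \<in> M" using x y closed by blast
  have 1: "real n / real k + real n' / real k' \<le> val u (x \<oplus> y)"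
    if a: "k > 0" "nmul n u \<sqsubseteq> nmul k x" and b: "k' > 0" "nmul n' u \<sqsubseteq> nmul k' y" for n k n' k'
  proof -
    have "nmul (k' * n) u \<sqsubseteq> nmul (k' * k) x"
      using a u x nmul_mono[of "nmul n u" "nmul k x" k'] by (simp add: nmul_mult)
    moreover have "nmul (k * n') u \<sqsubseteq> nmul (k' * k) y"
      using b u y nmul_mono[of "nmul n' u" "nmul k' y" k]
      by (simp add: nmul_mult[symmetric] mult.commute)
    ultimately have "nmul (k' * n + k * n') u \<sqsubseteq> nmul (k' * k) (x \<oplus> y)"
      using u x y by (simp add: nmul_plus nmul_add add_mono)
    from val_ge[OF xy _ this] a b show ?thesis by (simp add: field_simps)
  qed
  then have "real n / real k \<le> val u (x \<oplus> y) - val u y"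
    if a: "k > 0" "nmul n u \<sqsubseteq> nmul k x" for n k
  proof -
    have "val u y \<le> val u (x \<oplus> y) - real n / real k"
    proof (rule val_le[OF y])
      fix n' k' :: nat assume "k' > 0" "nmul n' u \<sqsubseteq> nmul k' y"
      with 1[OF a] show "real n' / real k' \<le> val u (x \<oplus> y) - real n / real k"
        by (simp add: algebra_simps)
    qed
    then show ?thesis by simp
  qed
  then show "val u x + val u y \<le> val u (x \<oplus> y)"
    using val_le[OF x, of "val u (x \<oplus> y) - val u y"] by (simp add: algebra_simps)
  show "val u (x \<oplus> y) \<le> val u x + val u y"
  proof (rule val_le[OF xy], rule field_le_epsilon)
    fix n k :: nat and e :: real
    assume k: "k > 0" "nmul n u \<sqsubseteq> nmul k (x \<oplus> y)" and e: "e > 0"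
    \<comment> \<open>Rounding the multiples of x and y down to multiples of u loses at most 2 u in
      total, that is 2 / (N k) in value, and N exceeds 2 / e.\<close>
    obtain N where N: "real N > 2 / e" using reals_Archimedean2 by blast
    then have "real N > 0" using e by (meson divide_pos_pos less_trans zero_less_numeral)
    then have N0: "N > 0" by simp
    obtain p where p: "nmul p u \<sqsubseteq> nmul (N * k) x" "nmul (N * k) x \<sqsubseteq> nmul (Suc p) u"
      using floor_ex[of "nmul (N * k) x"] x by auto
    obtain q where q: "nmul q u \<sqsubseteq> nmul (N * k) y" "nmul (N * k) y \<sqsubseteq> nmul (Suc q) u"
      using floor_ex[of "nmul (N * k) y"] y by auto
    have "nmul (N * n) u \<sqsubseteq> nmul (N * k) (x \<oplus> y)"
      using k u xy nmul_mono[of "nmul n u" "nmul k (x \<oplus> y)" N] by (simp add: nmul_mult)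
    moreover have "nmul (N * k) (x \<oplus> y) \<sqsubseteq> nmul (Suc p + Suc q) u"
      unfolding nmul_plus[OF u(1)] nmul_add[OF x y] using p q u x y by (intro add_mono) auto
    ultimately have "nmul (N * n) u \<sqsubseteq> nmul (Suc p + Suc q) u"
      using le_trans[of "nmul (N * n) u" "nmul (N * k) (x \<oplus> y)"] u xy nmul_in by blast
    then have "N * n \<le> Suc p + Suc q" using nmul_le_imp u by blast
    then have "real (N * n) \<le> real (Suc p + Suc q)" using of_nat_le_iff by blast
    then have "real N * real n \<le> real p + real q + 2" by simp
    then have "real n / real k \<le> (real p + real q + 2) / (real N * real k)"
      using N0 k by (simp add: field_simps)
    also have "\<dots> = real p / real (N * k) + real q / real (N * k) + 2 / (real N * real k)"
      by (simp add: add_divide_distrib)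
    also have "\<dots> \<le> val u x + val u y + 2 / (real N * real k)"
      using val_ge[OF x _ p(1)] val_ge[OF y _ q(1)] k N0 by simp
    also have "2 / (real N * real k) \<le> 2 / real N"
      using k N0 by (simp add: field_simps)
    also have "2 / real N \<le> e" using N N0 e by (simp add: field_simps)
    finally show "real n / real k \<le> val u x + val u y + e" by simp
  qed
qed

text \<open>The Archimedean property for multiples of z: once k z reaches u, the value of z is at
  least 1/k.\<close>

lemma val_pos:
  assumes "z \<in> M" "z \<noteq> \<zero>"
  shows "val u z > 0"
proof -
  obtain k where k: "\<not> nmul k z \<sqsubseteq> u" using archimedean assms u by blast
  then have "nmul 1 u \<sqsubseteq> nmul k z" using total[of u "nmul k z"] u assms by simp
  moreover have "k \<noteq> 0" using k u by (metis nmul_0 zero_le)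
  ultimately have "1 / real k \<le> val u z" using val_ge[of z k 1] assms by simp
  then show ?thesis using \<open>k \<noteq> 0\<close> by (smt (verit) divide_pos_pos of_nat_0_less_iff bot_nat_0.not_eq_extremum)
qed

lemma val_mono_iff:
  assumes x: "x \<in> M" and y: "y \<in> M"
  shows "val u x \<le> val u y \<longleftrightarrow> x \<sqsubseteq> y"
proof
  assume "x \<sqsubseteq> y"
  then show "val u x \<le> val u y" using le_iff x y val_add val_nonneg by force
next
  assume *: "val u x \<le> val u y"
  show "x \<sqsubseteq> y"
  proof (rule ccontr)
    assume n: "\<not> x \<sqsubseteq> y"
    then obtain z where z: "z \<in> M" "x = y \<oplus> z" using total le_iff x y by blast
    have "z \<noteq> \<zero>" using z n x y by (auto simp: zero_right le_refl)
    then show False using * z val_pos[of z] val_add[of y z] y by simp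
  qed
qed

lemma val_zero: "val u \<zero> = 0"
  using val_add[of \<zero> \<zero>] zero_in by (simp add: zero_left)

lemma val_nmul: "x \<in> M \<Longrightarrow> val u (nmul n x) = real n * val u x"
  by (induction n) (simp_all add: val_zero nmul_Suc val_add algebra_simps)

text \<open>The remainder of x after n copies of u is zero or, by minimality, at least u; in the
  second case x already reaches the next multiple.\<close>

lemma val_image_discrete:
  assumes least: "\<And>x. \<lbrakk>x \<in> M; x \<noteq> \<zero>\<rbrakk> \<Longrightarrow> u \<sqsubseteq> x"
  shows "val u ` M = range real"
proof
  show "val u ` M \<subseteq> range real"
  proof safe
    fix x assume x: "x \<in> M"
    obtain n where n: "nmul n u \<sqsubseteq> x" "x \<sqsubseteq> nmul (Suc n) u" using floor_ex x by blast
    then obtain z where z: "z \<in> M" "x = nmul n u \<oplus> z" using le_iff x u nmul_in by blast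
    then have v: "val u x = real n + val u z" using u by (simp add: val_add val_nmul val_unit)
    show "val u x \<in> range real"
    proof (cases "z = \<zero>")
      case True
      then show ?thesis using v by (simp add: val_zero)
    next
      case False
      then have "1 \<le> val u z" using least[of z] z val_mono_iff[of u z] u val_unit by simp
      moreover have "val u x \<le> real (Suc n)"
        using n(2) val_mono_iff[of x "nmul (Suc n) u"] x u by (simp add: val_nmul val_unit)
      ultimately have "val u x = real (Suc n)" using v by simp
      then show ?thesis by blast
    qed
  qed
  show "range real \<subseteq> val u ` M"
  proof safe
    fix n
    have "real n = val u (nmul n u)" using u by (simp add: val_nmul val_unit)
    then show "real n \<in> val u ` M" using u by simp
  qed
qed

text \<open>Halving produces arbitrarily small positive values. The supremum g of the elements of
  value at most r then has value r: a smaller value leaves room for a small summand, a larger one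
  allows a small subtraction.\<close>

lemma val_image_dense:
  assumes dense: "\<And>x. \<lbrakk>x \<in> M; x \<noteq> \<zero>\<rbrakk> \<Longrightarrow> \<exists>y\<in>M. y \<noteq> \<zero> \<and> \<not> x \<sqsubseteq> y"
  shows "val u ` M = {0..}"
proof
  show "val u ` M \<subseteq> {0..}" using val_nonneg by auto
  have half: "\<exists>y\<in>M. y \<noteq> \<zero> \<and> 2 * val u y \<le> val u x" if x: "x \<in> M" "x \<noteq> \<zero>" for x
  proof -
    obtain y where y: "y \<in> M" "y \<noteq> \<zero>" "\<not> x \<sqsubseteq> y" using dense x by blast
    then obtain z where z: "z \<in> M" "x = y \<oplus> z" using total le_iff x by blast
    then have "z \<noteq> \<zero>" using y by (auto simp: zero_right le_refl)
    moreover have "val u x = val u y + val u z" using z y val_add by simp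
    \<comment> \<open>x is the sum of the nonzero y and z, so the one of smaller value has at most
      half the value of x.\<close>
    ultimately show ?thesis using y z by (cases "val u y \<le> val u z") auto
  qed
  have pow: "\<exists>y\<in>M. y \<noteq> \<zero> \<and> 2 ^ n * val u y \<le> 1" for n :: nat
  proof (induction n)
    case 0
    then show ?case using u val_unit by auto
  next
    case (Suc n)
    then obtain y where y: "y \<in> M" "y \<noteq> \<zero>" "2 ^ n * val u y \<le> 1" by blast
    obtain z where z: "z \<in> M" "z \<noteq> \<zero>" "2 * val u z \<le> val u y" using half y by blast
    have "2 ^ Suc n * val u z \<le> 2 ^ n * val u y" using z by simp
    then have "2 ^ Suc n * val u z \<le> 1" using y by linarith
    then show ?case using z by blast
  qed
  have small: "\<exists>z\<in>M. z \<noteq> \<zero> \<and> val u z < e" if "e > 0" for e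
  proof -
    obtain n where n: "1 / e < 2 ^ n" using real_arch_pow[of 2 "1 / e"] by auto
    obtain z where z: "z \<in> M" "z \<noteq> \<zero>" "2 ^ n * val u z \<le> 1" using pow by blast
    have "1 < 2 ^ n * e" using n that by (simp add: field_simps)
    then have "2 ^ n * val u z < 2 ^ n * e" using z by linarith
    then show ?thesis using z by auto
  qed
  show "{0..} \<subseteq> val u ` M"
  proof
    fix r :: real assume "r \<in> {0..}"
    then have r: "0 \<le> r" by simp
    define S where "S = {x \<in> M. val u x \<le> r}"
    obtain N where N: "r \<le> real N" using real_arch_simple by blast
    have "x \<sqsubseteq> nmul N u" if "x \<in> S" for x
      using that N u val_mono_iff[of x "nmul N u"] by (simp add: S_def val_nmul val_unit)
    moreover have "\<zero> \<in> S" using zero_in val_zero r by (simp add: S_def)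
    ultimately have "\<exists>g\<in>M. (\<forall>s\<in>S. s \<sqsubseteq> g) \<and> (\<forall>h\<in>M. (\<forall>s\<in>S. s \<sqsubseteq> h) \<longrightarrow> g \<sqsubseteq> h)"
      using u by (intro sup_ex[where b = "nmul N u"]) (auto simp: S_def)
    then obtain g where g: "g \<in> M" "\<And>s. s \<in> S \<Longrightarrow> s \<sqsubseteq> g"
      and least: "\<And>h. \<lbrakk>h \<in> M; \<And>s. s \<in> S \<Longrightarrow> s \<sqsubseteq> h\<rbrakk> \<Longrightarrow> g \<sqsubseteq> h"
      by blast
    have "\<not> val u g < r"
    proof
      assume "val u g < r"
      then obtain z where z: "z \<in> M" "z \<noteq> \<zero>" "val u z < r - val u g" using small[of "r - val u g"] by auto
      then have "g \<oplus> z \<in> S" using g by (simp add: S_def closed val_add)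
      then have "val u (g \<oplus> z) \<le> val u g" using g z closed val_mono_iff by blast
      then show False using g z val_pos[of z] by (simp add: val_add)
    qed
    moreover have "\<not> r < val u g"
    proof
      assume "r < val u g"
      then obtain z where z: "z \<in> M" "z \<noteq> \<zero>" "val u z < val u g - r" using small[of "val u g - r"] by auto
      then have "val u z \<le> val u g" using r by simp
      then obtain h where h: "h \<in> M" "g = z \<oplus> h" using le_iff z g val_mono_iff by blast
      then have vg: "val u g = val u z + val u h" using z val_add by simp
      have "s \<sqsubseteq> h" if "s \<in> S" for s
        using that vg z h val_mono_iff[of s h] by (simp add: S_def)
      then have "g \<sqsubseteq> h" using least h by blast
      then have "val u g \<le> val u h" using val_mono_iff g h by blast
      then show False using vg val_pos z by fastforce
    qed
    ultimately show "r \<in> val u ` M" using g by force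
  qed
qed

end

text \<open>A least nonzero element serves as the unit and yields the natural numbers. If there is
  none, any nonzero unit does, and the absence of a least one is the hypothesis of
  \<open>val_image_dense\<close>.\<close>

theorem complete_cone_real:
  assumes "M \<noteq> {\<zero>}"
  obtains v :: "'a \<Rightarrow> real" where
    "\<And>x y. \<lbrakk>x \<in> M; y \<in> M\<rbrakk> \<Longrightarrow> v (x \<oplus> y) = v x + v y"
    "\<And>x y. \<lbrakk>x \<in> M; y \<in> M\<rbrakk> \<Longrightarrow> v x \<le> v y \<longleftrightarrow> x \<sqsubseteq> y"
    "v ` M = range real \<or> v ` M = {0..}"
proof (cases "\<exists>u\<in>M. u \<noteq> \<zero> \<and> (\<forall>x\<in>M. x \<noteq> \<zero> \<longrightarrow> u \<sqsubseteq> x)")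
  case True
  then obtain u where u: "u \<in> M" "u \<noteq> \<zero>" "\<And>x. \<lbrakk>x \<in> M; x \<noteq> \<zero>\<rbrakk> \<Longrightarrow> u \<sqsubseteq> x" by blast
  show ?thesis
    using that[of "val u"] val_add val_mono_iff val_image_discrete u by blast
next
  case False
  obtain u where u: "u \<in> M" "u \<noteq> \<zero>" using assms zero_in by blast
  show ?thesis
    using that[of "val u"] val_add val_mono_iff val_image_dense[OF u] u False by blast
qed

end

section \<open>C-lattice domains generated by principal elements\<close>

lemma compact_sup:
  assumes "ml_compact a" "ml_compact b"
  shows "ml_compact (sup a b)"
  unfolding ml_compact_def
proof (intro allI impI)
  fix S assume "sup a b \<le> Sup S"
  then obtain T U where "T \<subseteq> S" "finite T" "a \<le> Sup T" "U \<subseteq> S" "finite U" "b \<le> Sup U"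
    using assms unfolding ml_compact_def by (meson le_sup_iff)
  then show "\<exists>V\<subseteq>S. finite V \<and> sup a b \<le> Sup V"
    by (intro exI[of _ "T \<union> U"]) (auto simp: Sup_union_distrib le_supI1 le_supI2)
qed

lemma compact_bot: "ml_compact bot"
  unfolding ml_compact_def by (meson empty_subsetI finite.emptyI bot_least)

lemma compact_Sup: "finite T \<Longrightarrow> (\<And>t. t \<in> T \<Longrightarrow> ml_compact t) \<Longrightarrow> ml_compact (Sup T)"
  by (induction rule: finite_induct) (simp_all add: compact_bot compact_sup)

locale c_lattice_domain =
  fixes mult :: "'a::complete_lattice \<Rightarrow> 'a \<Rightarrow> 'a" (infixl "\<odot>" 70)
  assumes C: "C_lattice mult" and domain: "ml_domain mult"
    and pgen: "\<forall>x. \<exists>S. (\<forall>s\<in>S. ml_principal mult s) \<and> x = Sup S"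
begin

lemma assoc: "(a \<odot> b) \<odot> c = a \<odot> (b \<odot> c)"
  and comm: "a \<odot> b = b \<odot> a"
  and top_left [simp]: "top \<odot> a = a"
  and mult_Sup: "a \<odot> Sup B = Sup ((\<lambda>b. a \<odot> b) ` B)"
  and compact_top: "ml_compact (top::'a)"
  and compact_mult: "\<lbrakk>ml_compact a; ml_compact b\<rbrakk> \<Longrightarrow> ml_compact (a \<odot> b)"
  and compact_gen: "(x::'a) = Sup {c. ml_compact c \<and> c \<le> x}"
proof -
  have *: "mult_lattice mult" "ml_compact (top::'a)"
    "ml_compact a \<and> ml_compact b \<longrightarrow> ml_compact (a \<odot> b)" "\<forall>x::'a. x = Sup {c. ml_compact c \<and> c \<le> x}"
    using C unfolding C_lattice_def by simp_all
  from *(1) have m: "\<forall>a b c. (a \<odot> b) \<odot> c = a \<odot> (b \<odot> c)" "\<forall>a b. a \<odot> b = b \<odot> a"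
    "\<forall>a. top \<odot> a = a" "\<forall>a B. a \<odot> Sup B = Sup ((\<lambda>b. a \<odot> b) ` B)"
    unfolding mult_lattice_def by blast+
  show "(a \<odot> b) \<odot> c = a \<odot> (b \<odot> c)" using m(1) by blast
  show "a \<odot> b = b \<odot> a" using m(2) by blast
  show "top \<odot> a = a" using m(3) by blast
  show "a \<odot> Sup B = Sup ((\<lambda>b. a \<odot> b) ` B)" using m(4) by blast
  show "ml_compact (top::'a)" by fact
  show "\<lbrakk>ml_compact a; ml_compact b\<rbrakk> \<Longrightarrow> ml_compact (a \<odot> b)" using *(3) by blast
  show "(x::'a) = Sup {c. ml_compact c \<and> c \<le> x}" for x by (fact *(4)[rule_format])
qed

lemma top_right [simp]: "a \<odot> top = a"
  by (metis comm top_left)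

lemma left_comm: "a \<odot> (b \<odot> c) = b \<odot> (a \<odot> c)"
  by (metis assoc comm)

lemmas ac = assoc comm left_comm

lemma mult_bot [simp]: "a \<odot> bot = bot" "bot \<odot> a = bot"
  using mult_Sup[of a "{}"] comm[of bot a] by simp_all

lemma mult_sup: "a \<odot> sup b c = sup (a \<odot> b) (a \<odot> c)"
  using mult_Sup[of a "{b, c}"] by simp

lemma sup_mult: "sup b c \<odot> a = sup (b \<odot> a) (c \<odot> a)"
  by (metis comm mult_sup)

lemma mult_mono: "\<lbrakk>a \<le> b; c \<le> d\<rbrakk> \<Longrightarrow> a \<odot> c \<le> b \<odot> d"
  by (metis le_iff_sup mult_sup sup_mult sup.bounded_iff sup_ge2 order_trans)

lemma mult_le_left: "a \<odot> b \<le> a"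
  using mult_mono[of a a b top] by simp

lemma mult_le_right: "a \<odot> b \<le> b"
  using mult_mono[of a top b b] by simp

lemma mult_le_trans: "\<lbrakk>a \<le> b; b \<odot> c \<le> d\<rbrakk> \<Longrightarrow> a \<odot> c \<le> d"
  using mult_mono[of a b c c] by simp

lemma top_neq_bot: "top \<noteq> (bot::'a)"
  and mult_eq_bot: "a \<odot> b = bot \<longleftrightarrow> a = bot \<or> b = bot"
proof -
  show "top \<noteq> (bot::'a)" using domain unfolding ml_domain_def ml_prime_def by auto
  show "a \<odot> b = bot \<longleftrightarrow> a = bot \<or> b = bot"
    using domain unfolding ml_domain_def ml_prime_def by (metis bot_unique mult_bot)
qed

abbreviation colon (infixl "\<div>" 70) where "y \<div> x \<equiv> ml_colon mult y x"

lemma le_colon: "a \<le> y \<div> x \<longleftrightarrow> a \<odot> x \<le> y"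
proof
  have "(y \<div> x) \<odot> x = Sup ((\<lambda>a. a \<odot> x) ` {a. a \<odot> x \<le> y})"
    unfolding ml_colon_def by (simp add: comm[of _ x] mult_Sup)
  also have "\<dots> \<le> y" by (auto intro: Sup_least)
  finally show "a \<le> y \<div> x \<Longrightarrow> a \<odot> x \<le> y" using mult_mono order_trans order_refl by blast
  show "a \<odot> x \<le> y \<Longrightarrow> a \<le> y \<div> x" unfolding ml_colon_def by (simp add: Sup_upper)
qed

lemma colon_mult_le: "(y \<div> x) \<odot> x \<le> y"
  using le_colon by blast

text \<open>Nonzero elements that are weakly meet principal and weakly join principal; unlike the
  defining identities of a principal element, these conditions pass to factors at once.\<close>

definition prin :: "'a set" where
  "prin = {x. x \<noteq> bot \<and> (\<forall>y\<le>x. \<exists>z. y = z \<odot> x) \<and>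
    (\<forall>a c z. c \<odot> x \<le> sup (a \<odot> x) z \<longrightarrow> c \<le> sup a (z \<div> x))}"

lemma prin_divide: "\<lbrakk>x \<in> prin; y \<le> x\<rbrakk> \<Longrightarrow> \<exists>z. y = z \<odot> x"
  and prin_join: "\<lbrakk>x \<in> prin; c \<odot> x \<le> sup (a \<odot> x) z\<rbrakk> \<Longrightarrow> c \<le> sup a (z \<div> x)"
  and prin_nonbot: "x \<in> prin \<Longrightarrow> x \<noteq> bot"
  unfolding prin_def by auto

text \<open>In a domain \<open>bot \<div> x\<close> is \<open>bot\<close>, so the join condition
  with \<open>z = bot\<close> is cancellation.\<close>

lemma prin_cancel:
  assumes "x \<in> prin" "a \<odot> x \<le> b \<odot> x"
  shows "a \<le> b"
proof -
  have "bot \<div> x = bot" using colon_mult_le[of bot x] prin_nonbot[OF assms(1)]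
    by (metis bot_unique mult_eq_bot)
  then show ?thesis using prin_join[of x a b bot] assms by simp
qed

lemma principal_prin:
  assumes "ml_principal mult x" "x \<noteq> bot"
  shows "x \<in> prin"
proof -
  have "\<exists>z. y = z \<odot> x" if "y \<le> x" for y
    using assms(1) that unfolding ml_principal_def by (metis inf.absorb1 top_left)
  moreover have "c \<le> sup a (z \<div> x)" if "c \<odot> x \<le> sup (a \<odot> x) z" for a c z
    using assms(1) that unfolding ml_principal_def by (metis le_colon)
  ultimately show ?thesis using assms(2) unfolding prin_def by blast
qed

lemma prin_top: "top \<in> prin"
  using top_neq_bot unfolding prin_def by (auto simp: le_colon) (metis order_trans le_colon sup_mono order_refl top_right)

lemma prin_mult:
  assumes "x \<in> prin" "y \<in> prin"
  shows "x \<odot> y \<in> prin"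
  unfolding prin_def
proof (intro CollectI conjI allI impI)
  show "x \<odot> y \<noteq> bot" using assms mult_eq_bot prin_nonbot by blast
next
  fix w assume w: "w \<le> x \<odot> y"
  then have "w \<le> y" using mult_le_right order_trans by blast
  then obtain z where z: "w = z \<odot> y" using prin_divide assms by blast
  then have "z \<le> x" using w prin_cancel assms by blast
  then show "\<exists>z. w = z \<odot> (x \<odot> y)" using prin_divide[OF assms(1)] z by (metis assoc)
next
  fix a c z assume *: "c \<odot> (x \<odot> y) \<le> sup (a \<odot> (x \<odot> y)) z"
  then have "c \<odot> x \<le> sup (a \<odot> x) (z \<div> y)" using prin_join[of y "c \<odot> x" "a \<odot> x" z] assms by (simp add: assoc)
  then have "c \<le> sup a ((z \<div> y) \<div> x)" using prin_join assms by blast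
  also have "(z \<div> y) \<div> x \<le> z \<div> (x \<odot> y)"
    using colon_mult_le le_colon assoc by metis
  finally show "c \<le> sup a (z \<div> (x \<odot> y))" by (simp add: le_supI2 sup_mono)
qed

text \<open>Each condition for x is multiplied by y, settled for \<open>x \<odot> y\<close>, and
  freed of y again; y can be cancelled because the product can.\<close>

lemma prin_factor:
  assumes "x \<odot> y \<in> prin"
  shows "x \<in> prin"
  unfolding prin_def
proof (intro CollectI conjI allI impI)
  have can: "a \<le> b" if "a \<odot> y \<le> b \<odot> y" for a b
  proof (rule prin_cancel[OF assms])
    show "a \<odot> (x \<odot> y) \<le> b \<odot> (x \<odot> y)" using mult_mono[OF order_refl that, of x] by (simp add: ac)
  qed
  show "x \<noteq> bot" using prin_nonbot[OF assms] mult_eq_bot by blast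
  show "\<exists>z. w = z \<odot> x" if "w \<le> x" for w
  proof -
    have "w \<odot> y \<le> x \<odot> y" using that mult_mono by blast
    then obtain z where "w \<odot> y = z \<odot> (x \<odot> y)" using prin_divide assms by blast
    then have "w = z \<odot> x" by (metis can antisym assoc order_refl)
    then show ?thesis by blast
  qed
  show "c \<le> sup a (z \<div> x)" if "c \<odot> x \<le> sup (a \<odot> x) z" for a c z
  proof -
    have "c \<odot> (x \<odot> y) \<le> sup (a \<odot> (x \<odot> y)) (z \<odot> y)"
      using mult_mono[OF that order_refl, of y] by (simp add: sup_mult assoc)
    then have "c \<le> sup a ((z \<odot> y) \<div> (x \<odot> y))" using prin_join assms by blast
    also have "(z \<odot> y) \<div> (x \<odot> y) \<le> z \<div> x"
      by (metis can colon_mult_le le_colon assoc)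
    finally show ?thesis by (simp add: le_supI2 sup_mono)
  qed
qed

lemma prin_factor2: "x \<odot> y \<in> prin \<Longrightarrow> y \<in> prin"
  using prin_factor comm by metis

lemma prin_gen: "x = Sup {q \<in> prin. q \<le> x}"
proof (rule antisym)
  obtain S where S: "\<forall>s\<in>S. ml_principal mult s" "x = Sup S" using pgen by blast
  have "s \<le> Sup {q \<in> prin. q \<le> x}" if "s \<in> S" for s
    using that S principal_prin[of s] by (cases "s = bot") (auto intro: Sup_upper)
  then show "x \<le> Sup {q \<in> prin. q \<le> x}" using S by (simp add: Sup_least)
qed (auto intro: Sup_least)

lemma le_if_prin: "(\<And>q. \<lbrakk>q \<in> prin; q \<le> x\<rbrakk> \<Longrightarrow> q \<le> y) \<Longrightarrow> x \<le> y"
  by (subst prin_gen) (auto intro: Sup_least)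

text \<open>Presents a product as a join of principal products, from which join-primeness can later
  select a single one. Residuating first by b and then by g avoids a double join.\<close>

lemma mult_le_Sup_prin:
  "a \<odot> b \<le> Sup {g \<odot> h |g h. g \<in> prin \<and> g \<le> a \<and> h \<in> prin \<and> h \<le> b}" (is "_ \<le> Sup ?A")
proof -
  have "a \<le> Sup ?A \<div> b"
  proof (rule le_if_prin)
    fix g assume g: "g \<in> prin" "g \<le> a"
    have "b \<le> Sup ?A \<div> g"
    proof (rule le_if_prin)
      fix h assume h: "h \<in> prin" "h \<le> b"
      then have "g \<odot> h \<in> ?A" using g by blast
      then show "h \<le> Sup ?A \<div> g" by (simp add: le_colon comm[of h g] Sup_upper)
    qed
    then show "g \<le> Sup ?A \<div> b" by (simp add: le_colon comm[of b g])
  qed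
  then show ?thesis by (simp add: le_colon)
qed

lemma le_if_compact: "(\<And>c. \<lbrakk>ml_compact c; c \<le> x\<rbrakk> \<Longrightarrow> c \<le> y) \<Longrightarrow> x \<le> (y::'a)"
  by (subst compact_gen) (auto intro: Sup_least)

text \<open>If \<open>x = \<Squnion> c\<^sub>i\<close> with compact \<open>c\<^sub>i = z\<^sub>i x\<close>, then cancelling \<open>x\<close> gives \<open>\<Squnion> z\<^sub>i = 1\<close>, and \<open>1\<close> is compact.\<close>

lemma prin_compact:
  assumes "x \<in> prin"
  shows "ml_compact x"
proof -
  define Z where "Z = {z. ml_compact (z \<odot> x)}"
  have "top \<odot> x \<le> Sup Z \<odot> x"
  proof (rule le_if_compact)
    fix c assume c: "ml_compact c" "c \<le> top \<odot> x"
    then obtain z where z: "c = z \<odot> x" using prin_divide assms by auto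
    then have "z \<in> Z" using c by (simp add: Z_def)
    then show "c \<le> Sup Z \<odot> x" unfolding z by (intro mult_mono) (auto intro: Sup_upper)
  qed
  then have "top \<le> Sup Z" using prin_cancel assms by blast
  then obtain T where T: "T \<subseteq> Z" "finite T" "top \<le> Sup T" using compact_top unfolding ml_compact_def by blast
  have "x = x \<odot> Sup T" using T by (simp add: top_unique)
  also have "\<dots> = Sup ((\<lambda>b. x \<odot> b) ` T)" by (rule mult_Sup)
  finally show ?thesis using compact_Sup[of "(\<lambda>b. x \<odot> b) ` T"] T by (auto simp: Z_def comm)
qed

text \<open>Zorn's lemma: a chain of proper elements has a proper join because \<open>top\<close> is
  compact and a finite part of a nonempty chain lies below one of its members.\<close>

lemma maximal_ex:
  assumes "x \<noteq> (top::'a)"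
  shows "\<exists>m. ml_maximal m \<and> x \<le> m"
proof -
  define A where "A = {y. x \<le> y \<and> y \<noteq> top}"
  have "\<exists>m\<in>A. \<forall>a\<in>A. m \<le> a \<longrightarrow> a = m"
  proof (rule predicate_Zorn)
    show "partial_order_on A (relation_of (\<le>) A)"
      by (rule partial_order_on_relation_ofI) auto
    fix K assume K: "K \<in> Chains (relation_of (\<le>) A)"
    then have KA: "K \<subseteq> A" and ch: "\<And>a b. \<lbrakk>a \<in> K; b \<in> K\<rbrakk> \<Longrightarrow> a \<le> b \<or> b \<le> a"
      unfolding Chains_def relation_of_def by auto
    show "\<exists>u\<in>A. \<forall>a\<in>K. a \<le> u"
    proof (cases "K = {}")
      case True
      then show ?thesis using assms by (auto simp: A_def)
    next
      case False
      have "Sup K \<noteq> top"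
      proof
        assume "Sup K = top"
        then obtain T where T: "T \<subseteq> K" "finite T" "top \<le> Sup T" using compact_top unfolding ml_compact_def by (metis order_refl)
        have "\<exists>k\<in>K. Sup T \<le> k" using \<open>finite T\<close> \<open>T \<subseteq> K\<close>
        proof (induction rule: finite_induct)
          case empty
          then show ?case using False by auto
        next
          case (insert t T)
          then obtain k where "k \<in> K" "Sup T \<le> k" by auto
          then show ?case using ch[of t k] insert.prems by (auto intro: order_trans)
        qed
        then show False using T KA by (auto simp: A_def top_unique)
      qed
      moreover have "x \<le> Sup K" using False KA by (auto simp: A_def intro: Sup_upper2)
      ultimately show ?thesis by (intro bexI[of _ "Sup K"]) (auto simp: A_def intro: Sup_upper)
    qed
  qed
  then obtain m where "m \<in> A" "\<forall>a\<in>A. m \<le> a \<longrightarrow> a = m" by blast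
  then have "ml_maximal m \<and> x \<le> m" unfolding ml_maximal_def A_def by (auto intro: order_trans)
  then show ?thesis by blast
qed

end

section \<open>Localization at a maximal element as a closure operator\<close>

locale c_lattice_max = c_lattice_domain mult for mult :: "'a::complete_lattice \<Rightarrow> 'a \<Rightarrow> 'a" (infixl "\<odot>" 70) +
  fixes m :: 'a
  assumes max: "ml_maximal m"
begin

lemma m_prime: "x \<odot> y \<le> m \<longleftrightarrow> x \<le> m \<or> y \<le> m"
proof
  assume *: "x \<odot> y \<le> m"
  have s: "sup m x = top" if "\<not> x \<le> m" for x
    using max that unfolding ml_maximal_def by (metis sup_ge1 sup_ge2)
  show "x \<le> m \<or> y \<le> m"
  proof (rule ccontr)
    assume "\<not> (x \<le> m \<or> y \<le> m)"
    then have "top = sup m x \<odot> sup m y" using s by simp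
    also have "\<dots> \<le> m" using * by (auto simp: mult_sup sup_mult mult_le_left mult_le_right)
    finally show False using max unfolding ml_maximal_def by (simp add: top_unique)
  qed
qed (meson mult_le_left mult_le_right order_trans)

abbreviation j where "j \<equiv> ml_loc mult m"

text \<open>The join in the definition of \<open>ml_loc\<close> hides the denominators s. A compact
  c uses finitely many of them, and their product is a common one, still not below m by
  \<open>m_prime\<close>.\<close>

lemma compact_le_j:
  assumes "ml_compact c"
  shows "c \<le> j x \<longleftrightarrow> (\<exists>s. ml_compact s \<and> \<not> s \<le> m \<and> c \<odot> s \<le> x)"
proof
  assume "c \<le> j x"
  then obtain T where T: "finite T" "c \<le> Sup T"
    "\<And>t. t \<in> T \<Longrightarrow> ml_compact t \<and> (\<exists>s. ml_compact s \<and> \<not> s \<le> m \<and> t \<odot> s \<le> x)"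
    using assms unfolding ml_compact_def ml_loc_def by (smt (verit) mem_Collect_eq subset_iff)
  have "\<exists>s. ml_compact s \<and> \<not> s \<le> m \<and> Sup T \<odot> s \<le> x" using T(1,3)
  proof (induction rule: finite_induct)
    case empty
    show ?case using compact_top max unfolding ml_maximal_def by (intro exI[of _ top]) (auto simp: top_unique)
  next
    case (insert t T)
    then obtain s s' where s: "ml_compact s" "\<not> s \<le> m" "Sup T \<odot> s \<le> x"
      and s': "ml_compact s'" "\<not> s' \<le> m" "t \<odot> s' \<le> x" by blast
    have "sup t (Sup T) \<odot> (s \<odot> s') \<le> x"
      unfolding sup_mult using s(3) s'(3) mult_le_left[of "Sup T \<odot> s" s'] mult_le_left[of "t \<odot> s'" s]
      by (auto simp: ac)
    then show ?case using s s' by (intro exI[of _ "s \<odot> s'"]) (simp add: m_prime compact_mult)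
  qed
  then show "\<exists>s. ml_compact s \<and> \<not> s \<le> m \<and> c \<odot> s \<le> x"
    using mult_le_trans[OF T(2)] by blast
next
  assume "\<exists>s. ml_compact s \<and> \<not> s \<le> m \<and> c \<odot> s \<le> x"
  then show "c \<le> j x" using assms unfolding ml_loc_def by (auto intro!: Sup_upper)
qed

lemma j_incr: "x \<le> j x"
proof (rule le_if_compact)
  fix c assume "ml_compact c" "c \<le> x"
  then show "c \<le> j x"
    using compact_top max unfolding ml_maximal_def by (auto simp: compact_le_j top_unique intro!: exI[of _ top])
qed

lemma j_mono:
  assumes "x \<le> y"
  shows "j x \<le> j y"
proof (rule le_if_compact)
  fix c assume c: "ml_compact c" "c \<le> j x"
  then obtain s where "ml_compact s" "\<not> s \<le> m" "c \<odot> s \<le> x" using compact_le_j by blast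
  moreover from this have "c \<odot> s \<le> y" using assms by simp
  ultimately show "c \<le> j y" using compact_le_j[OF c(1)] by blast
qed

lemma j_idem [simp]: "j (j x) = j x"
proof (rule antisym)
  show "j (j x) \<le> j x"
  proof (rule le_if_compact)
    fix c assume c: "ml_compact c" "c \<le> j (j x)"
    then obtain s where s: "ml_compact s" "\<not> s \<le> m" "c \<odot> s \<le> j x" using compact_le_j by blast
    then obtain t where t: "ml_compact t" "\<not> t \<le> m" "c \<odot> s \<odot> t \<le> x" using compact_le_j compact_mult c by blast
    then show "c \<le> j x" using c s unfolding compact_le_j[OF c(1)]
      by (intro exI[of _ "s \<odot> t"]) (simp add: compact_mult m_prime assoc)
  qed
qed (rule j_incr)

text \<open>The closure property of \<open>j\<close>; it allows inequalities in \<open>L_m\<close>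
  to be tested with an unlocalized left side.\<close>

lemma j_le_iff: "j x \<le> j y \<longleftrightarrow> x \<le> j y"
  using j_incr[of x] j_mono[of x "j y"] by (auto intro: order_trans[OF j_incr])

lemma j_mult_le: "j x \<odot> y \<le> j (x \<odot> y)"
proof -
  have "j x \<le> j (x \<odot> y) \<div> y"
  proof (rule le_if_compact, unfold le_colon)
    fix c assume c: "ml_compact c" "c \<le> j x"
    then obtain s where s: "ml_compact s" "\<not> s \<le> m" "c \<odot> s \<le> x" using compact_le_j by blast
    have "y \<le> j (x \<odot> y) \<div> c"
    proof (rule le_if_compact, unfold le_colon)
      fix d assume d: "ml_compact d" "d \<le> y"
      have "(d \<odot> c) \<odot> s \<le> x \<odot> y" using mult_mono[OF s(3) d(2)] by (simp add: ac)
      then show "d \<odot> c \<le> j (x \<odot> y)" using compact_le_j[of "d \<odot> c"] compact_mult c d s by blast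
    qed
    then show "c \<odot> y \<le> j (x \<odot> y)" by (simp add: le_colon comm)
  qed
  then show ?thesis by (simp add: le_colon)
qed

text \<open>Products in \<open>L_m\<close> may be computed from arbitrary representatives.\<close>

lemma j_mult: "j (j x \<odot> y) = j (x \<odot> y)" "j (x \<odot> j y) = j (x \<odot> y)"
proof -
  show "j (j x \<odot> y) = j (x \<odot> y)" for x y
    by (intro antisym) (simp_all add: j_le_iff[of "j x \<odot> y"] j_mult_le j_mono mult_mono j_incr)
  then show "j (x \<odot> j y) = j (x \<odot> y)" by (metis comm)
qed

text \<open>\<open>top \<le> j x\<close> means that some compact s not below m lies below x; since
  compact elements generate, this happens whenever x is not below m.\<close>

lemma j_top_iff: "j x = top \<longleftrightarrow> \<not> x \<le> m"
proof -
  have "j x = top \<longleftrightarrow> (\<exists>s. ml_compact s \<and> \<not> s \<le> m \<and> s \<le> x)"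
    using compact_le_j[OF compact_top, of x] by (simp add: top_unique)
  also have "\<dots> \<longleftrightarrow> \<not> x \<le> m" using le_if_compact[of x m] order_trans[of _ x m] by blast
  finally show ?thesis .
qed

lemma j_top [simp]: "j top = top"
  using j_incr top_unique by blast

lemma j_bot [simp]: "j bot = bot"
proof -
  have "j bot \<le> bot"
    by (rule le_if_compact) (auto simp: compact_le_j bot_unique mult_eq_bot)
  then show ?thesis by (simp add: bot_unique)
qed

text \<open>Two denominators multiply to a common one. The argument covers finite meets, which is
  why finite character matters in the gluing.\<close>

lemma j_inf: "j (inf x y) = inf (j x) (j y)"
proof (rule antisym)
  show "inf (j x) (j y) \<le> j (inf x y)"
  proof (rule le_if_compact)
    fix c assume c: "ml_compact c" "c \<le> inf (j x) (j y)"
    then obtain s t where s: "ml_compact s" "\<not> s \<le> m" "c \<odot> s \<le> x"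
      and t: "ml_compact t" "\<not> t \<le> m" "c \<odot> t \<le> y" using compact_le_j by (metis le_inf_iff)
    have "c \<odot> (s \<odot> t) \<le> x" "c \<odot> (s \<odot> t) \<le> y"
      using s t mult_le_left[of "c \<odot> s" t] mult_le_left[of "c \<odot> t" s] by (auto simp: ac)
    then show "c \<le> j (inf x y)" using c s t
      by (auto simp: compact_le_j compact_mult m_prime intro!: exI[of _ "s \<odot> t"])
  qed
qed (simp add: j_mono)

lemma j_Inf_closed:
  assumes "\<And>s. s \<in> S \<Longrightarrow> j s = s"
  shows "j (Inf S) = Inf S"
proof (rule antisym)
  show "j (Inf S) \<le> Inf S"
    by (rule Inf_greatest) (metis assms j_mono Inf_lower)
qed (rule j_incr)

end

context c_lattice_domain
begin

lemma maximal_locale: "ml_maximal n \<Longrightarrow> c_lattice_max mult n"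
  by unfold_locales

text \<open>Suppose c \<le> x is compact and y : c is proper, hence below a maximal n. The
  denominator witnessing c \<le> y at n lies below y : c \<le> n, which a denominator may
  not.\<close>

lemma le_if_local:
  assumes "\<And>n. ml_maximal n \<Longrightarrow> x \<le> ml_loc mult n y"
  shows "x \<le> y"
proof (rule le_if_compact)
  fix c assume c: "ml_compact c" "c \<le> x"
  have "y \<div> c = top"
  proof (rule ccontr)
    assume "y \<div> c \<noteq> top"
    then obtain n where n: "ml_maximal n" "y \<div> c \<le> n" using maximal_ex by blast
    interpret c_lattice_max mult n using n maximal_locale by blast
    have "c \<le> j y" using order_trans[OF c(2) assms[OF n(1)]] .
    then obtain s where s: "\<not> s \<le> n" "s \<odot> c \<le> y" using compact_le_j c comm by metis
    then have "s \<le> y \<div> c" by (simp add: le_colon)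
    then show False using n(2) s(1) by simp
  qed
  then have "top \<le> y \<div> c" by simp
  then show "c \<le> y" by (simp only: le_colon top_left)
qed

end

section \<open>Sharp lattices\<close>

locale sharp_lattice = c_lattice_domain +
  assumes sharp: "ml_sharp mult"
begin

lemma sharpE:
  assumes "a1 \<odot> a2 \<le> b"
  obtains b1 b2 where "a1 \<le> b1" "a2 \<le> b2" "b = b1 \<odot> b2"
  using sharp assms unfolding ml_sharp_def by blast

text \<open>Sharpness is applied to (b : a) a \<le> b. A factor b1 above b : a satisfies b1 a \<le>
  b1 b2 = b, so it equals b : a; the other factor is bounded by b : (b : a), and replacing it by
  this residual keeps the product below b.\<close>

lemma double_colon: "b = (b \<div> a) \<odot> (b \<div> (b \<div> a))"
proof -
  obtain b1 b2 where b: "b \<div> a \<le> b1" "a \<le> b2" "b = b1 \<odot> b2"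
    using sharpE[OF colon_mult_le[of b a]] by blast
  have "b1 \<odot> a \<le> b" using b(2,3) mult_mono[of b1 b1 a b2] by simp
  then have b1: "b1 = b \<div> a" using b(1) le_colon by (simp add: antisym)
  have "b2 \<odot> b1 \<le> b" using b(3) comm by simp
  then have "b2 \<le> b \<div> (b \<div> a)" unfolding b1 by (simp only: le_colon)
  then have "b1 \<odot> b2 \<le> b1 \<odot> (b \<div> (b \<div> a))" by (rule mult_mono[OF order_refl])
  from order_trans[OF eq_refl[OF b(3)] this]
  have "b \<le> (b \<div> a) \<odot> (b \<div> (b \<div> a))" unfolding b1 .
  moreover have "(b \<div> a) \<odot> (b \<div> (b \<div> a)) \<le> b" using colon_mult_le comm by metis
  ultimately show ?thesis by (rule antisym)
qed

text \<open>Sharpness is applied to w w \<le> \<open>sup (x \<odot> x) y\<close> with w the join of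
  x and y. Coprimality forces both factors down to w, so y lies below w w, which is the join of w y
  and x x; cancelling y yields \<open>top\<close>.\<close>

lemma prin_comaximal:
  assumes x: "x \<in> prin" and y: "y \<in> prin" and disj: "x \<div> y = x" "y \<div> x = y"
  shows "sup x y = top"
proof -
  let ?w = "sup x y" and ?b = "sup (x \<odot> x) y"
  have "?w \<odot> ?w \<le> ?b"
    by (auto simp: mult_sup sup_mult mult_le_left mult_le_right le_supI1 le_supI2)
  then obtain b1 b2 where b: "?w \<le> b1" "?w \<le> b2" "?b = b1 \<odot> b2" by (rule sharpE)
  have "b1 \<odot> x \<le> ?b" "b2 \<odot> x \<le> ?b"
    using b mult_mono[of b1 b1 x b2] mult_mono[of b2 b2 x b1] by (simp_all add: comm)
  \<comment> \<open>Cancelling x bounds both factors by the join of x and y : x, which is w because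
    y : x = y.\<close>
  then have "b1 \<le> ?w" "b2 \<le> ?w" using prin_join[OF x, of _ x y] disj by simp_all
  then have "?b = ?w \<odot> ?w" using b antisym by metis
  then have "y \<le> ?w \<odot> ?w" by (metis sup_ge2)
  then have "top \<odot> y \<le> sup (?w \<odot> y) (x \<odot> x)"
    by (auto simp: mult_sup sup_mult comm sup_commute sup_left_commute)
  then have "top \<le> sup ?w ((x \<odot> x) \<div> y)" using prin_join[OF y] by blast
  moreover have "(x \<odot> x) \<div> y \<le> x \<div> y"
    unfolding le_colon by (rule order_trans[OF colon_mult_le mult_le_left])
  ultimately have "top \<le> sup ?w (x \<div> y)" using sup_mono[OF order_refl, of _ "x \<div> y" ?w] order_trans by blast
  then show ?thesis unfolding disj(1) by (simp add: top_unique sup_commute sup_left_commute)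
qed

text \<open>Sharpness for the product of join and meet gives x y = d l, a common divisor d and a
  common multiple l. Since d is above x and y, cancellation bounds l by both, so l is exactly the
  meet; the cofactors then have trivial residuals and \<open>prin_comaximal\<close> applies.\<close>

lemma prin_gcd:
  assumes x: "x \<in> prin" and y: "y \<in> prin"
  obtains d x' y' where "d \<in> prin" "x' \<in> prin" "y' \<in> prin" "x = x' \<odot> d" "y = y' \<odot> d" "sup x' y' = top"
proof -
  have "sup x y \<odot> inf x y \<le> x \<odot> y"
    unfolding sup_mult using mult_mono[of x x "inf x y" y] mult_mono[of y y "inf x y" x] by (simp add: comm[of y x])
  then obtain d l where b: "sup x y \<le> d" "inf x y \<le> l" "x \<odot> y = d \<odot> l" by (rule sharpE)
  have dl: "d \<odot> l \<in> prin" using prin_mult[OF x y] b(3) by simp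
  then have d: "d \<in> prin" and "l \<in> prin" using prin_factor prin_factor2 by blast+
  have "l \<odot> x \<le> y \<odot> x" "l \<odot> y \<le> x \<odot> y"
    using b mult_mono[of l l x d] mult_mono[of l l y d] by (simp_all add: comm)
  then have "l \<le> y" "l \<le> x" using prin_cancel x y by blast+
  then have l: "l = inf x y" using b(2) by (simp add: antisym)
  obtain x' y' where xy: "x = x' \<odot> d" "y = y' \<odot> d" using prin_divide[OF d] b(1) by (metis le_sup_iff)
  then have x': "x' \<in> prin" and y': "y' \<in> prin" using prin_factor x y by blast+
  have "(x' \<odot> y' \<odot> d) \<odot> d = l \<odot> d" using b(3) unfolding xy by (simp add: ac)
  then have l': "l = x' \<odot> y' \<odot> d" by (metis prin_cancel d antisym order_refl)
  \<comment> \<open>Stated for fresh variables so that it serves both ways round. A z with z x'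
    \<le> y' satisfies z x \<le> \<open>inf x y\<close> = y' x, and x cancels.\<close>
  have key: "y' \<div> x' = y'" if xy: "x = x' \<odot> d" "y = y' \<odot> d" and l': "l = x' \<odot> y' \<odot> d"
    and x': "x' \<in> prin" and l: "l = inf x y" for x y x' y'
  proof (rule antisym)
    let ?z = "y' \<div> x'"
    have "?z \<odot> x' \<odot> d \<le> inf x y"
      using mult_mono[OF colon_mult_le[of y' x'] order_refl[of d]] mult_le_right[of ?z x]
      unfolding xy by (simp add: assoc)
    then have "?z \<odot> (x' \<odot> d) \<le> y' \<odot> (x' \<odot> d)" using l l' by (simp add: ac)
    then show "?z \<le> y'" using prin_cancel prin_mult[OF x' d] by blast
  qed (simp add: le_colon mult_le_left)
  have "y' \<div> x' = y'" using key[OF xy l' x' l] .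
  moreover have "x' \<div> y' = x'" using key[of y y' x x'] xy l' y' l by (simp add: inf_commute comm)
  ultimately have "sup x' y' = top" using prin_comaximal x' y' by blast
  with that d x' y' xy show ?thesis by blast
qed

end

section \<open>The cone of localized principal elements\<close>

locale sharp_max = sharp_lattice mult + c_lattice_max mult m
  for mult :: "'a::complete_lattice \<Rightarrow> 'a \<Rightarrow> 'a" (infixl "\<odot>" 70) and m
begin

text \<open>For compact c \<le> a the hypothesis reads c x s \<le> b x, and x cancels in L
  itself.\<close>

lemma j_cancel:
  assumes x: "x \<in> prin" and le: "a \<odot> x \<le> j (b \<odot> x)"
  shows "a \<le> j b"
proof (rule le_if_compact)
  fix c assume c: "ml_compact c" "c \<le> a"
  have "c \<odot> x \<le> j (b \<odot> x)" using mult_le_trans c(2) le by blast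
  then obtain s where s: "ml_compact s" "\<not> s \<le> m" "c \<odot> x \<odot> s \<le> b \<odot> x"
    using compact_le_j compact_mult prin_compact x c(1) by blast
  then have "c \<odot> s \<le> b" using prin_cancel[OF x, of "c \<odot> s" b] by (simp add: ac)
  then show "c \<le> j b" using compact_le_j c s by blast
qed

text \<open>Comaximal cofactors cannot both lie below m. If y' does not, then y has the same
  localization as d, and x is a multiple of d.\<close>

lemma j_total:
  assumes "x \<in> prin" "y \<in> prin"
  shows "x \<le> j y \<or> y \<le> j x"
proof -
  obtain d x' y' where *: "x = x' \<odot> d" "y = y' \<odot> d" "sup x' y' = top" using prin_gcd assms by metis
  have aux: "x' \<odot> d \<le> j (y' \<odot> d)" if "\<not> y' \<le> m" for x' y'
    using that j_mult(1)[of y' d] j_top_iff[of y'] mult_le_right[of x' d] j_incr[of d] by simp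
  have "\<not> x' \<le> m \<or> \<not> y' \<le> m"
    using *(3) max unfolding ml_maximal_def by (metis le_sup_iff top_unique)
  then show ?thesis using aux * by blast
qed

text \<open>Clearing the denominator leaves the compact \<open>x \<odot> s\<close> below a join, so
  finitely many members suffice, and \<open>j_total\<close> provides a largest one among them up to
  localization.\<close>

lemma j_prime:
  assumes x: "x \<in> prin" and A: "A \<subseteq> prin" and le: "x \<le> j (Sup A)"
  shows "\<exists>a\<in>A. x \<le> j a"
proof -
  obtain s where s: "ml_compact s" "\<not> s \<le> m" "x \<odot> s \<le> Sup A" using compact_le_j prin_compact x le by blast
  then obtain T where T: "T \<subseteq> A" "finite T" "x \<odot> s \<le> Sup T"
    using compact_mult[OF prin_compact[OF x]] unfolding ml_compact_def by metis
  have "T = {} \<or> (\<exists>a\<in>T. \<forall>t\<in>T. t \<le> j a)" using T(2) T(1)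
  proof (induction rule: finite_induct)
    case (insert t T)
    then show ?case
    proof (cases "T = {}")
      case False
      then obtain a where a: "a \<in> T" "\<forall>t\<in>T. t \<le> j a" using insert by auto
      then have "t \<le> j a \<or> a \<le> j t" using j_total insert.prems A by blast
      then show ?thesis
      proof
        assume "a \<le> j t"
        then have "\<forall>u\<in>T. u \<le> j t" using a(2) j_le_iff[of a t] by (meson order_trans)
        then show ?thesis by (auto simp: j_incr)
      qed (use a in auto)
    qed (auto simp: j_incr)
  qed simp
  \<comment> \<open>The join of an empty T would be \<open>bot\<close>, whereas a product of nonzero
    elements is nonzero in a domain.\<close>
  moreover have "x \<odot> s \<noteq> bot" using prin_nonbot[OF x] s(2) mult_eq_bot by auto
  then have "T \<noteq> {}" using T(3) by (auto simp: bot_unique)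
  ultimately obtain a where a: "a \<in> T" "\<forall>t\<in>T. t \<le> j a" by blast
  then have "x \<odot> s \<le> j a" using T(3) by (meson Sup_least order_trans)
  then have "x \<le> j (j a)" using compact_le_j[OF prin_compact[OF x]] s by blast
  then show ?thesis using a T(1) by auto
qed

text \<open>The denominator s is replaced by a principal t below it, still not below m. Then
  \<open>x \<odot> t\<close> is principal, so its factor z is too, and t disappears in the
  localization.\<close>

lemma j_divide:
  assumes x: "x \<in> prin" and y: "y \<in> prin" and le: "x \<le> j y"
  obtains z where "z \<in> prin" "j x = j (z \<odot> y)"
proof -
  obtain s where s: "\<not> s \<le> m" "x \<odot> s \<le> y" using compact_le_j prin_compact x le by blast
  then obtain t where t: "t \<in> prin" "t \<le> s" "\<not> t \<le> m" using le_if_prin by blast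
  then have "x \<odot> t \<le> y" using mult_mono[of x x t s] s(2) by simp
  then obtain z where z: "x \<odot> t = z \<odot> y" using prin_divide y by blast
  then have "z \<in> prin" using prin_mult[OF x t(1)] prin_factor by metis
  moreover have "j x = j (z \<odot> y)"
    using j_mult(2)[of x t] j_top_iff[of t] t z by simp
  ultimately show ?thesis using that by blast
qed

abbreviation M where "M \<equiv> j ` prin"

text \<open>Each s divides b locally, which makes the infimum a double residual;
  \<open>double_colon\<close> then exhibits it as a factor of b. By \<open>j_prime\<close> a single
  principal product already reaches b, and cancelling its second factor shows that the first one
  localizes to the infimum.\<close>

lemma M_Inf:
  assumes S: "S \<subseteq> M" "S \<noteq> {}" and b: "b \<in> M" "\<And>s. s \<in> S \<Longrightarrow> b \<le> s"
  shows "Inf S \<in> M"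
proof -
  let ?g = "Inf S"
  let ?h = "b \<div> ?g"
  obtain b0 where b0: "b0 \<in> prin" "b = j b0" using b by blast
  have closed: "j s = s" if "s \<in> S" for s using S that by auto
  \<comment> \<open>If t is the cofactor of s0 in b, then t ?g \<le> t s \<le> b puts t below
    \<open>?h\<close>. So (b : ?h) t \<le> b = j (s0 t), and t cancels.\<close>
  have "b \<div> ?h \<le> ?g"
  proof (rule Inf_greatest)
    fix s assume s: "s \<in> S"
    then obtain s0 where s0: "s0 \<in> prin" "s = j s0" using S by blast
    have "b0 \<le> j s0" using b(2)[OF s] b0 s0 j_le_iff by simp
    then obtain t where t: "t \<in> prin" "b = j (t \<odot> s0)" using j_divide[OF b0(1) s0(1)] b0(2) by metis
    have "t \<odot> ?g \<le> t \<odot> j s0" using s s0 by (intro mult_mono) (auto intro: Inf_lower)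
    also have "\<dots> \<le> b" using j_mult_le[of s0 t] t by (simp add: comm)
    finally have "t \<le> ?h" by (simp add: le_colon)
    then have "(b \<div> ?h) \<odot> t \<le> (b \<div> ?h) \<odot> ?h" by (intro mult_mono) auto
    also have "\<dots> \<le> b" by (rule colon_mult_le)
    finally have "(b \<div> ?h) \<odot> t \<le> j (s0 \<odot> t)" using t by (simp add: comm)
    then show "b \<div> ?h \<le> s" using j_cancel[OF t(1)] s0 by blast
  qed
  moreover have "?g \<le> b \<div> ?h" using colon_mult_le[of b ?g] by (simp add: le_colon comm)
  ultimately have "b \<div> ?h = ?g" by (rule antisym)
  then have bgh: "b = ?g \<odot> ?h" using double_colon[of b ?g] comm by simp
  define A where "A = {g \<odot> h |g h. g \<in> prin \<and> g \<le> ?g \<and> h \<in> prin \<and> h \<le> ?h}"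
  have AQ: "A \<subseteq> prin" using prin_mult by (auto simp: A_def)
  have "b \<le> Sup A" unfolding A_def by (subst bgh) (rule mult_le_Sup_prin)
  then have "b0 \<le> j (Sup A)" using b0(2) j_incr by (metis order_trans)
  then obtain a where "a \<in> A" "b0 \<le> j a" using j_prime[OF b0(1) AQ] by blast
  then obtain g h where gh: "g \<in> prin" "g \<le> ?g" "h \<in> prin" "h \<le> ?h" "b0 \<le> j (g \<odot> h)" by (auto simp: A_def)
  \<comment> \<open>Here h is principal and below \<open>?h\<close>: ?g h \<le> ?g ?h = b \<le> j (g
    h), and h cancels.\<close>
  have "?g \<odot> h \<le> ?g \<odot> ?h" using gh by (intro mult_mono) auto
  also have "\<dots> = j b0" using bgh b0 by simp
  also have "\<dots> \<le> j (g \<odot> h)" using gh j_le_iff by simp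
  finally have "?g \<le> j g" using j_cancel gh by blast
  moreover have "j g \<le> ?g" using j_mono[OF gh(2)] j_Inf_closed[of S] closed by simp
  ultimately have "?g = j g" by (rule antisym)
  then show ?thesis using gh by blast
qed

text \<open>The order is reversed: divisors are smaller in the cone, \<open>top\<close> is its zero,
  and its bounded suprema are the infima of \<open>M_Inf\<close>.\<close>

lemma M_cone: "complete_cone M (loc_mult mult m) top (\<lambda>x y. y \<le> x)"
proof unfold_locales
  show closed: "loc_mult mult m x y \<in> M" if "x \<in> M" "y \<in> M" for x y
    using that prin_mult unfolding loc_mult_def by (auto simp: j_mult)
  show "loc_mult mult m (loc_mult mult m x y) z = loc_mult mult m x (loc_mult mult m y z)" for x y z
    by (simp add: loc_mult_def j_mult assoc)
  show com: "loc_mult mult m x y = loc_mult mult m y x" for x y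
    by (simp add: loc_mult_def comm)
  show "top \<in> M" using prin_top j_top by (metis image_eqI)
  show "loc_mult mult m top x = x" if "x \<in> M" for x
    using that by (auto simp: loc_mult_def)
  show "y = z" if M: "x \<in> M" "y \<in> M" "z \<in> M" and eq: "loc_mult mult m x y = loc_mult mult m x z" for x y z
  proof -
    obtain x0 y0 z0 where *: "x0 \<in> prin" "x = j x0" "y = j y0" "z = j z0" using M by blast
    have "j (y0 \<odot> x0) = j (z0 \<odot> x0)" using eq * by (simp add: loc_mult_def j_mult comm)
    then have "y0 \<le> j z0" "z0 \<le> j y0" using j_cancel[OF *(1)] by (metis j_incr)+
    then show ?thesis using * j_le_iff by (simp add: antisym)
  qed
  show "y \<le> x \<or> x \<le> y" if "x \<in> M" "y \<in> M" for x y
    using that j_total j_le_iff by auto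
  show "y \<le> x \<longleftrightarrow> (\<exists>z\<in>M. y = loc_mult mult m x z)" if M: "x \<in> M" "y \<in> M" for x y
  proof
    obtain x0 y0 where *: "x0 \<in> prin" "x = j x0" "y0 \<in> prin" "y = j y0" using M by blast
    assume "y \<le> x"
    then obtain z where "z \<in> prin" "y = j (z \<odot> x0)" using * j_le_iff j_divide by metis
    then show "\<exists>z\<in>M. y = loc_mult mult m x z"
      using * by (intro bexI[of _ "j z"]) (auto simp: loc_mult_def j_mult comm)
  next
    assume "\<exists>z\<in>M. y = loc_mult mult m x z"
    then show "y \<le> x" using M(1) j_mono[OF mult_le_left] unfolding loc_mult_def by auto (metis j_idem)
  qed
  show "\<exists>g\<in>M. (\<forall>s\<in>S. g \<le> s) \<and> (\<forall>h\<in>M. (\<forall>s\<in>S. h \<le> s) \<longrightarrow> h \<le> g)"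
    if "S \<subseteq> M" "S \<noteq> {}" "b \<in> M" "\<And>s. s \<in> S \<Longrightarrow> b \<le> s" for S b
    using M_Inf[OF that] by (intro bexI[of _ "Inf S"]) (auto intro: Inf_lower Inf_greatest)
qed (auto intro: antisym)

end

section \<open>The model lattices\<close>

definition Rc :: "real \<Rightarrow> ereal set" where "Rc r = {x. ereal r \<le> x}"
definition Ro :: "real \<Rightarrow> ereal set" where "Ro r = {x. ereal r < x}"

lemma R1_cases:
  assumes "I \<in> R1"
  obtains "I = {\<infinity>}" | r where "r \<ge> 0" "I = Rc r" | r where "r \<ge> 0" "I = Ro r"
  using assms unfolding R1_def Rc_def Ro_def by blast

lemma R1_in: "{\<infinity>} \<in> R1" "r \<ge> 0 \<Longrightarrow> Rc r \<in> R1" "r \<ge> 0 \<Longrightarrow> Ro r \<in> R1"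
  unfolding R1_def Rc_def Ro_def by blast+

lemma Rc_conv: "Rc r = insert \<infinity> (ereal ` {r..})"
proof (rule set_eqI)
  fix x show "x \<in> Rc r \<longleftrightarrow> x \<in> insert \<infinity> (ereal ` {r..})" by (cases x) (auto simp: Rc_def)
qed

lemma Ro_conv: "Ro r = insert \<infinity> (ereal ` {r<..})"
proof (rule set_eqI)
  fix x show "x \<in> Ro r \<longleftrightarrow> x \<in> insert \<infinity> (ereal ` {r<..})" by (cases x) (auto simp: Ro_def)
qed

text \<open>Infinity absorbs the sums formed here, so computations reduce to sums of sets of reals;
  the empty set of reals stands for \<open>{\<infinity>}\<close>.\<close>

lemma interval_add_conv:
  "interval_add (insert \<infinity> (ereal ` A)) (insert \<infinity> (ereal ` B)) =
    insert \<infinity> (ereal ` {a + b |a b. a \<in> A \<and> b \<in> B})"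
  (is "?l = ?r")
proof
  show "?l \<subseteq> ?r"
  proof
    fix x assume "x \<in> ?l"
    then obtain a b where x: "x = a + b" and ab: "a = \<infinity> \<or> a \<in> ereal ` A" "b = \<infinity> \<or> b \<in> ereal ` B"
      unfolding interval_add_def by blast
    from ab show "x \<in> ?r"
      by (elim disjE imageE) (use x in auto)
  qed
  show "?r \<subseteq> ?l"
  proof
    fix x assume "x \<in> ?r"
    then consider "x = \<infinity> + \<infinity>" | a b where "a \<in> A" "b \<in> B" "x = ereal a + ereal b" by auto
    then show "x \<in> ?l"
      unfolding interval_add_def by cases blast+
  qed
qed

lemma insert_inf_subset_iff: "insert \<infinity> (ereal ` A) \<subseteq> insert \<infinity> (ereal ` B) \<longleftrightarrow> A \<subseteq> B"
  by auto

lemma insert_inf_eq_iff: "insert \<infinity> (ereal ` A) = insert \<infinity> (ereal ` B) \<longleftrightarrow> A = B"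
  using insert_inf_subset_iff by (metis subset_antisym order_refl)

lemma interval_add_comm: "interval_add A B = interval_add B A"
  unfolding interval_add_def by (metis add.commute)

lemma sum_cc: "{a + b |a b. a \<in> {r..} \<and> b \<in> {s..}} = {r + s..}" for r s :: real
proof (intro equalityI subsetI)
  fix x assume "x \<in> {r + s..}"
  then show "x \<in> {a + b |a b. a \<in> {r..} \<and> b \<in> {s..}}"
    unfolding mem_Collect_eq by (intro exI[of _ r] exI[of _ "x - r"]) auto
qed auto

lemma sum_co: "{a + b |a b. a \<in> {r..} \<and> b \<in> {s<..}} = {r + s<..}" for r s :: real
proof (intro equalityI subsetI)
  fix x assume "x \<in> {r + s<..}"
  then show "x \<in> {a + b |a b. a \<in> {r..} \<and> b \<in> {s<..}}"
    unfolding mem_Collect_eq by (intro exI[of _ r] exI[of _ "x - r"]) auto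
qed auto

lemma sum_oo: "{a + b |a b. a \<in> {r<..} \<and> b \<in> {s<..}} = {r + s<..}" for r s :: real
proof (intro equalityI subsetI)
  fix x assume "x \<in> {r + s<..}"
  then show "x \<in> {a + b |a b. a \<in> {r<..} \<and> b \<in> {s<..}}"
    unfolding mem_Collect_eq
    \<comment> \<open>The positive surplus x - r - s is shared equally, which keeps both bounds
      strict.\<close>
    by (intro exI[of _ "r + (x - r - s) / 2"] exI[of _ "s + (x - r - s) / 2"]) auto
qed auto

lemma interval_add_R [simp]:
  "interval_add (Rc r) (Rc s) = Rc (r + s)" "interval_add (Rc r) (Ro s) = Ro (r + s)"
  "interval_add (Ro r) (Rc s) = Ro (r + s)" "interval_add (Ro r) (Ro s) = Ro (r + s)"
proof -
  show co: "interval_add (Rc r) (Ro s) = Ro (r + s)" for r s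
    unfolding Rc_conv Ro_conv interval_add_conv sum_co ..
  show "interval_add (Ro r) (Rc s) = Ro (r + s)"
    using co[of s r] by (simp add: interval_add_comm add.commute)
qed (simp_all add: Rc_conv Ro_conv interval_add_conv sum_cc sum_oo del: atLeast_iff greaterThan_iff)

lemma interval_add_inf:
  "I \<in> R1 \<Longrightarrow> interval_add {\<infinity>} I = {\<infinity>}" "I \<in> R1 \<Longrightarrow> interval_add I {\<infinity>} = {\<infinity>}"
proof -
  have *: "interval_add {\<infinity>} I = {\<infinity>}" if "I \<in> R1" for I
  proof -
    have "\<exists>A. I = insert \<infinity> (ereal ` A)"
      using that
    proof (cases rule: R1_cases)
      case 1
      then show ?thesis by (intro exI[of _ "{}"]) simp
    qed (auto simp: Rc_conv Ro_conv)
    then obtain A where "I = insert \<infinity> (ereal ` A)" ..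
    then show ?thesis using interval_add_conv[of "{}" A] by simp
  qed
  then show "I \<in> R1 \<Longrightarrow> interval_add {\<infinity>} I = {\<infinity>}" "I \<in> R1 \<Longrightarrow> interval_add I {\<infinity>} = {\<infinity>}"
    by (simp_all add: interval_add_comm[of I])
qed

lemma R_subset_iff:
  "Rc r \<subseteq> Rc s \<longleftrightarrow> s \<le> r" "Ro r \<subseteq> Ro s \<longleftrightarrow> s \<le> r" "Ro r \<subseteq> Rc s \<longleftrightarrow> s \<le> r" "Rc r \<subseteq> Ro s \<longleftrightarrow> s < r"
  unfolding Rc_conv Ro_conv insert_inf_subset_iff
  by (auto intro: dense_ge)

lemma R_subset_Rc: "\<lbrakk>I = Rc s \<or> I = Ro s; r \<le> s\<rbrakk> \<Longrightarrow> I \<subseteq> Rc r"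
  by (elim disjE) (simp_all add: R_subset_iff)

lemma Rc_subset_R: "\<lbrakk>I = Rc s \<or> I = Ro s; s < r\<rbrakk> \<Longrightarrow> Rc r \<subseteq> I"
  by (elim disjE) (simp_all add: R_subset_iff)

lemma R_not_inf: "\<not> Rc r \<subseteq> {\<infinity>}" "\<not> Ro r \<subseteq> {\<infinity>}"
  using insert_inf_subset_iff[of "{r..}" "{}"] insert_inf_subset_iff[of "{r<..}" "{}"]
  by (simp_all add: Rc_conv Ro_conv)

lemma inf_subset: "I \<in> R1 \<Longrightarrow> {\<infinity>} \<subseteq> I"
  by (cases rule: R1_cases) (auto simp: Rc_def Ro_def)

lemma subset_Rc0: "I \<in> R1 \<Longrightarrow> I \<subseteq> Rc 0"
  by (erule R1_cases) (simp_all add: R_subset_iff, simp add: Rc_def)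

section \<open>Sharpness and the Archimedean property of the models\<close>

definition sharp_on :: "'a set \<Rightarrow> ('a \<Rightarrow> 'a \<Rightarrow> bool) \<Rightarrow> ('a \<Rightarrow> 'a \<Rightarrow> 'a) \<Rightarrow> bool" where
  "sharp_on A le mul \<longleftrightarrow> (\<forall>a1\<in>A. \<forall>a2\<in>A. \<forall>b\<in>A. le (mul a1 a2) b \<longrightarrow>
    (\<exists>b1\<in>A. \<exists>b2\<in>A. le a1 b1 \<and> le a2 b2 \<and> b = mul b1 b2))"

text \<open>Phrased by carrier, order and product alone, so that it transfers along
  \<open>mlat_iso\<close>: t is nonzero in the sense of not being least, and the n-fold iteration
  starts at x, giving the power n + 1 without naming a unit.\<close>

definition archimedean_on :: "'a set \<Rightarrow> ('a \<Rightarrow> 'a \<Rightarrow> bool) \<Rightarrow> ('a \<Rightarrow> 'a \<Rightarrow> 'a) \<Rightarrow> bool" where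
  "archimedean_on A le mul \<longleftrightarrow> (\<forall>x\<in>A. \<forall>t\<in>A. mul x x \<noteq> x \<longrightarrow> (\<exists>y\<in>A. \<not> le t y) \<longrightarrow>
    (\<exists>n. le ((mul x ^^ n) x) t))"

lemma mlat_iso_sharp_archimedean:
  assumes iso: "mlat_iso A leA mulA B leB mulB"
    and closed: "\<And>x y. \<lbrakk>x \<in> A; y \<in> A\<rbrakk> \<Longrightarrow> mulA x y \<in> A"
    and B: "sharp_on B leB mulB" "archimedean_on B leB mulB"
  shows "sharp_on A leA mulA" "archimedean_on A leA mulA"
proof -
  obtain f where bij: "bij_betw f A B"
    and le: "\<And>x y. \<lbrakk>x \<in> A; y \<in> A\<rbrakk> \<Longrightarrow> leA x y \<longleftrightarrow> leB (f x) (f y)"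
    and mul: "\<And>x y. \<lbrakk>x \<in> A; y \<in> A\<rbrakk> \<Longrightarrow> f (mulA x y) = mulB (f x) (f y)"
    using iso unfolding mlat_iso_def by auto
  have inB: "f x \<in> B" if "x \<in> A" for x using that bij bij_betwE by blast
  have inj: "f x = f y \<longleftrightarrow> x = y" if "x \<in> A" "y \<in> A" for x y
    using that bij by (auto simp: bij_betw_def inj_on_def)
  have surj: "\<exists>x\<in>A. y = f x" if "y \<in> B" for y using that bij by (auto simp: bij_betw_def)
  show "sharp_on A leA mulA"
    unfolding sharp_on_def
  proof (intro ballI impI)
    fix a1 a2 b assume A: "a1 \<in> A" "a2 \<in> A" "b \<in> A" and "leA (mulA a1 a2) b"
    then have "leB (mulB (f a1) (f a2)) (f b)" using le mul closed by simp
    then obtain c1 c2 where c: "c1 \<in> B" "c2 \<in> B" "leB (f a1) c1" "leB (f a2) c2" "f b = mulB c1 c2"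
      using B(1) inB A unfolding sharp_on_def by blast
    then obtain b1 b2 where b: "b1 \<in> A" "b2 \<in> A" "c1 = f b1" "c2 = f b2" using surj by blast
    then have "f b = f (mulA b1 b2)" using c mul by simp
    then have "b = mulA b1 b2" using inj A b closed by blast
    then show "\<exists>b1\<in>A. \<exists>b2\<in>A. leA a1 b1 \<and> leA a2 b2 \<and> b = mulA b1 b2"
      using b c A le by blast
  qed
  show "archimedean_on A leA mulA"
    unfolding archimedean_on_def
  proof (intro ballI impI)
    fix x t assume A: "x \<in> A" "t \<in> A" "mulA x x \<noteq> x" "\<exists>y\<in>A. \<not> leA t y"
    then have "mulB (f x) (f x) \<noteq> f x" using mul inj closed by metis
    moreover have "\<exists>y\<in>B. \<not> leB (f t) y" using A le inB by blast
    ultimately obtain n where n: "leB ((mulB (f x) ^^ n) (f x)) (f t)"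
      using B(2) A inB unfolding archimedean_on_def by blast
    have "(mulA x ^^ n) x \<in> A \<and> f ((mulA x ^^ n) x) = (mulB (f x) ^^ n) (f x)"
      by (induction n) (simp_all add: A closed mul)
    then show "\<exists>n. leA ((mulA x ^^ n) x) t" using n A le by metis
  qed
qed

lemma Zminus_cases:
  assumes "x \<in> Zminus"
  obtains "x = -\<infinity>" | k :: int where "k \<le> 0" "x = ereal (real_of_int k)"
  using assms unfolding Zminus_def by blast

lemma Zminus_in: "-\<infinity> \<in> Zminus" "k \<le> 0 \<Longrightarrow> ereal (real_of_int k) \<in> Zminus"
  unfolding Zminus_def by blast+

lemma Zminus_nonpos: "x \<in> Zminus \<Longrightarrow> x \<le> 0"
  by (cases rule: Zminus_cases) auto

lemma sharp_on_Zminus: "sharp_on Zminus (\<le>) (+)"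
  unfolding sharp_on_def
proof (intro ballI impI)
  fix a1 a2 b :: ereal
  assume A: "a1 \<in> Zminus" "a2 \<in> Zminus" "b \<in> Zminus" and le: "a1 + a2 \<le> b"
  have 0: "(0::ereal) \<in> Zminus" using Zminus_in(2)[of 0] by (simp add: zero_ereal_def)
  show "\<exists>b1\<in>Zminus. \<exists>b2\<in>Zminus. a1 \<le> b1 \<and> a2 \<le> b2 \<and> b = b1 + b2"
  proof (cases "a1 = -\<infinity>")
    case True
    then show ?thesis using A 0 Zminus_nonpos by (intro bexI[of _ b] bexI[of _ 0]) auto
  next
    case 1: False
    show ?thesis
    proof (cases "a2 = -\<infinity>")
      case True
      then show ?thesis using A 0 Zminus_nonpos by (intro bexI[of _ b] bexI[of _ 0]) auto
    next
      case False
      then obtain k l where kl: "k \<le> 0" "a1 = ereal (real_of_int k)" "l \<le> 0" "a2 = ereal (real_of_int l)"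
        using A 1 by (metis Zminus_cases)
      then obtain n where n: "n \<le> 0" "b = ereal (real_of_int n)" using le A by (auto elim: Zminus_cases)
      have "real_of_int (k + l) \<le> real_of_int n" using le kl n by simp
      then have "k + l \<le> n" by linarith
      \<comment> \<open>The first factor is as close to k as b permits; the second, n - max k n =
        min (n - k) 0, is at least l because k + l \<le> n and l \<le> 0.\<close>
      then show ?thesis using kl n
        by (intro bexI[of _ "ereal (real_of_int (max k n))"] bexI[of _ "ereal (real_of_int (n - max k n))"] Zminus_in)
          auto
    qed
  qed
qed

lemma archimedean_on_Zminus: "archimedean_on Zminus (\<le>) (+)"
  unfolding archimedean_on_def
proof (intro ballI impI)
  fix x t :: ereal
  assume A: "x \<in> Zminus" "t \<in> Zminus" and x: "x + x \<noteq> x" and t: "\<exists>y\<in>Zminus. \<not> t \<le> y"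
  obtain k where k: "k \<le> 0" "x = ereal (real_of_int k)" using A(1) x by (auto elim: Zminus_cases)
  obtain l where l: "l \<le> 0" "t = ereal (real_of_int l)" using A(2) t by (auto elim: Zminus_cases)
  have "k \<noteq> 0" using k x by (auto simp: zero_ereal_def)
  have pow: "((+) x ^^ n) x = ereal (real_of_int ((int n + 1) * k))" for n
    by (induction n) (simp_all add: k algebra_simps)
  \<comment> \<open>With n = -l the power has exponent 1 - l, and k \<le> -1 bounds it by l -
    1.\<close>
  have "(int (nat (- l)) + 1) * k \<le> (1 - l) * (-1)"
    using \<open>k \<noteq> 0\<close> k l mult_left_mono[of k "-1" "1 - l"] by simp
  then have "(int (nat (- l)) + 1) * k \<le> l" using l by simp
  then show "\<exists>n. ((+) x ^^ n) x \<le> t"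
    unfolding pow l(2) by (intro exI[of _ "nat (- l)"]) (simp only: ereal_less_eq of_int_le_iff)
qed

text \<open>The endpoint r of b is split as s' + t' with s' \<le> s and t' \<le> t. A closed b takes
  two closed factors; an open b needs an open factor, placed where the split leaves slack.\<close>

lemma sharp_on_R1: "sharp_on R1 (\<subseteq>) interval_add"
  unfolding sharp_on_def
proof (intro ballI impI)
  fix a1 a2 b assume A: "a1 \<in> R1" "a2 \<in> R1" "b \<in> R1" and le: "interval_add a1 a2 \<subseteq> b"
  have unit: "interval_add b (Rc 0) = b" "interval_add (Rc 0) b = b" if "b \<in> R1" for b
    using that by (cases rule: R1_cases; simp add: interval_add_inf R1_in)+
  have Rc0: "Rc 0 \<in> R1" by (simp add: R1_in)
  show "\<exists>b1\<in>R1. \<exists>b2\<in>R1. a1 \<subseteq> b1 \<and> a2 \<subseteq> b2 \<and> b = interval_add b1 b2"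
  proof (cases "a1 = {\<infinity>} \<or> a2 = {\<infinity>}")
    case True
    then show ?thesis
    proof
      assume "a1 = {\<infinity>}"
      then show ?thesis using A unit inf_subset subset_Rc0 Rc0
        by (intro bexI[of _ b] bexI[of _ "Rc 0"]) auto
    next
      assume "a2 = {\<infinity>}"
      then show ?thesis using A unit inf_subset subset_Rc0 Rc0
        by (intro bexI[of _ "Rc 0"] bexI[of _ b]) auto
    qed
  next
    case False
    then obtain s where s: "s \<ge> 0" "a1 = Rc s \<or> a1 = Ro s" using A(1) by (auto elim: R1_cases)
    obtain t where t: "t \<ge> 0" "a2 = Rc t \<or> a2 = Ro t" using A(2) False by (auto elim: R1_cases)
    have sub: "a1 \<subseteq> Rc s" "a2 \<subseteq> Rc t" using s t R_subset_Rc by blast+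
    have bne: "b \<noteq> {\<infinity>}" using le s t R_not_inf by auto
    then obtain r where r: "r \<ge> 0" "b = Rc r \<or> b = Ro r" using A(3) by (auto elim: R1_cases)
    have "Ro (s + t) \<subseteq> interval_add a1 a2" using s(2) t(2) by (elim disjE) (simp_all add: R_subset_iff)
    then have "Ro (s + t) \<subseteq> Rc r" using le r R_subset_Rc[of b r r] by blast
    then have st: "r \<le> s + t" by (simp add: R_subset_iff)
    define s' t' where "s' = min s r" and "t' = r - s'"
    have s't': "0 \<le> s'" "s' \<le> s" "0 \<le> t'" "t' \<le> t" "s' + t' = r"
      using s t r st by (auto simp: s'_def t'_def)
    from r(2) show ?thesis
    proof
      assume b: "b = Rc r"
      have "a1 \<subseteq> Rc s'" "a2 \<subseteq> Rc t'" using s t s't' R_subset_Rc by blast+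
      then show ?thesis using b s't' by (intro bexI[of _ "Rc s'"] bexI[of _ "Rc t'"]) (auto simp: R1_in)
    next
      assume b: "b = Ro r"
      consider "s' < s" | "t' < t" | "s' = s" "t' = t" using s't' by linarith
      then show ?thesis
      proof cases
        case 1
        then have "a1 \<subseteq> Ro s'" "a2 \<subseteq> Rc t'"
          using sub s't' R_subset_iff(4)[of s s'] R_subset_iff(1)[of t t'] by blast+
        then show ?thesis using b s't' by (intro bexI[of _ "Ro s'"] bexI[of _ "Rc t'"]) (auto simp: R1_in)
      next
        case 2
        then have "a1 \<subseteq> Rc s'" "a2 \<subseteq> Ro t'"
          using sub s't' R_subset_iff(4)[of t t'] R_subset_iff(1)[of s s'] by blast+
        then show ?thesis using b s't' by (intro bexI[of _ "Rc s'"] bexI[of _ "Ro t'"]) (auto simp: R1_in)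
      next
        case 3
        \<comment> \<open>Without slack s + t = r. Two closed intervals would add up to
          \<open>Rc r\<close>, which does not fit into \<open>Ro r\<close>, so one of the given
          intervals is open.\<close>
        have "\<not> (a1 = Rc s \<and> a2 = Rc t)"
          using le unfolding b by (clarify, simp) (simp add: R_subset_iff 3[symmetric] s't')
        then have "a1 = Ro s \<or> a2 = Ro t" using s t by blast
        then show ?thesis
        proof
          assume "a1 = Ro s"
          then show ?thesis using sub b s't' 3 s t by (intro bexI[of _ "Ro s"] bexI[of _ "Rc t"]) (auto simp: R1_in)
        next
          assume "a2 = Ro t"
          then show ?thesis using sub b s't' 3 s t by (intro bexI[of _ "Rc s"] bexI[of _ "Ro t"]) (auto simp: R1_in)
        qed
      qed
    qed
  qed
qed

lemma interval_add_mono: "\<lbrakk>A \<subseteq> B; C \<subseteq> D\<rbrakk> \<Longrightarrow> interval_add A C \<subseteq> interval_add B D"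
  unfolding interval_add_def by blast

lemma archimedean_on_R1: "archimedean_on R1 (\<subseteq>) interval_add"
  unfolding archimedean_on_def
proof (intro ballI impI)
  fix x t assume A: "x \<in> R1" "t \<in> R1" and x: "interval_add x x \<noteq> x" and t: "\<exists>y\<in>R1. \<not> t \<subseteq> y"
  have "x \<noteq> {\<infinity>}" using x interval_add_inf R1_in(1) by blast
  then obtain r where r: "r \<ge> 0" "x = Rc r \<or> x = Ro r" using A(1) by (auto elim: R1_cases)
  \<comment> \<open>Both \<open>Rc 0\<close> and \<open>Ro 0\<close> are idempotent.\<close>
  then have "r \<noteq> 0" using x by auto
  have "t \<noteq> {\<infinity>}" using t inf_subset by blast
  then obtain s where s: "s \<ge> 0" "t = Rc s \<or> t = Ro s" using A(2) by (auto elim: R1_cases)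
  have xr: "x \<subseteq> Rc r" using r R_subset_Rc by blast
  have pow: "(interval_add x ^^ n) x \<subseteq> Rc ((real n + 1) * r)" for n
  proof (induction n)
    case (Suc n)
    have "(interval_add x ^^ Suc n) x \<subseteq> interval_add (Rc r) (Rc ((real n + 1) * r))"
      using interval_add_mono[OF xr Suc] by simp
    then show ?case by (simp add: algebra_simps)
  qed (use xr in simp)
  obtain n where "s / r < real n" using reals_Archimedean2 by blast
  then have "s < (real n + 1) * r" using \<open>r \<noteq> 0\<close> r by (simp add: field_simps)
  then have "Rc ((real n + 1) * r) \<subseteq> t" using s Rc_subset_R by blast
  then show "\<exists>n. (interval_add x ^^ n) x \<subseteq> t" using pow by blast
qed

section \<open>From upward closed sets of values to the models\<close>

text \<open>\<open>V a\<close> is meant as the set of values of the principal elements below a, and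
  \<open>W\<close> as the set of all values. \<open>V_mul\<close> closes the sumset upwards inside
  \<open>W\<close>, a form that can be verified before \<open>W\<close> is known to be discrete or
  continuous.\<close>

locale value_sets =
  fixes R :: "'a::order set" and mul :: "'a \<Rightarrow> 'a \<Rightarrow> 'a" and V :: "'a \<Rightarrow> real set" and W :: "real set"
  assumes V_le: "\<lbrakk>a \<in> R; b \<in> R\<rbrakk> \<Longrightarrow> a \<le> b \<longleftrightarrow> V a \<subseteq> V b"
    and V_image: "V ` R = {A. A \<subseteq> W \<and> (\<forall>p\<in>A. \<forall>q\<in>W. p \<le> q \<longrightarrow> q \<in> A)}"
    and V_mul: "\<lbrakk>a \<in> R; b \<in> R\<rbrakk> \<Longrightarrow> V (mul a b) = {t \<in> W. \<exists>p\<in>V a. \<exists>q\<in>V b. p + q \<le> t}"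
begin

lemma V_inj: "inj_on V R"
  by (rule inj_onI) (simp add: V_le antisym)

text \<open>An upward closed set of nonnegative reals is empty or a ray from its infimum, with or
  without the endpoint; adjoining \<open>\<infinity>\<close> gives the three kinds of members of
  \<open>R1\<close>.\<close>

lemma mlat_iso_R1:
  assumes W: "W = {0..}"
  shows "mlat_iso R (\<le>) mul R1 (\<subseteq>) interval_add"
proof -
  define f where "f a = insert \<infinity> (ereal ` V a)" for a
  have up: "V a \<subseteq> {0..}" "\<And>p q. \<lbrakk>p \<in> V a; p \<le> q\<rbrakk> \<Longrightarrow> q \<in> V a" if "a \<in> R" for a
  proof -
    have "V a \<in> {A. A \<subseteq> W \<and> (\<forall>p\<in>A. \<forall>q\<in>W. p \<le> q \<longrightarrow> q \<in> A)}" using that V_image by blast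
    then show "V a \<subseteq> {0..}" "\<And>p q. \<lbrakk>p \<in> V a; p \<le> q\<rbrakk> \<Longrightarrow> q \<in> V a" unfolding W by auto
  qed
  have "f ` R = R1"
  proof
    show "f ` R \<subseteq> R1"
    proof safe
      fix a assume a: "a \<in> R"
      show "f a \<in> R1"
      proof (cases "V a = {}")
        case True
        then show ?thesis by (simp add: f_def R1_in)
      next
        case False
        have bdd: "bdd_below (V a)" using up(1)[OF a] by (auto intro: bdd_belowI[of _ 0])
        define r where "r = Inf (V a)"
        have r0: "r \<ge> 0" unfolding r_def using False up(1)[OF a] by (intro cInf_greatest) auto
        have ge: "r \<le> p" if "p \<in> V a" for p unfolding r_def using that bdd by (rule cInf_lower)
        have gt: "p \<in> V a" if p: "r < p" for p
        proof -
          obtain q where "q \<in> V a" "q < p" using p False unfolding r_def by (meson bdd cInf_less_iff)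
          then show ?thesis using up(2)[OF a] by auto
        qed
        show ?thesis
        proof (cases "r \<in> V a")
          case True
          then have "V a = {r..}" using ge up(2)[OF a] by auto
          then show ?thesis using r0 by (simp add: f_def R1_in flip: Rc_conv)
        next
          case False
          then have "V a = {r<..}" using ge gt by (auto simp: less_le)
          then show ?thesis using r0 by (simp add: f_def R1_in flip: Ro_conv)
        qed
      qed
    qed
    show "R1 \<subseteq> f ` R"
    proof
      fix I assume "I \<in> R1"
      then obtain A where A: "I = insert \<infinity> (ereal ` A)" "A \<subseteq> {0..}" "\<forall>p\<in>A. \<forall>q\<ge>0. p \<le> q \<longrightarrow> q \<in> A"
      proof (cases rule: R1_cases)
        case 1 then show ?thesis using that[of "{}"] by auto
      next
        case (2 r) then show ?thesis by (intro that[of "{r..}"]) (auto simp: Rc_conv)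
      next
        case (3 r) then show ?thesis by (intro that[of "{r<..}"]) (auto simp: Ro_conv)
      qed
      then have "A \<in> V ` R" unfolding V_image W by auto
      then show "I \<in> f ` R" using A by (auto simp: f_def)
    qed
  qed
  moreover have "inj_on f R"
    using V_inj by (auto simp: inj_on_def f_def insert_inf_eq_iff)
  ultimately have "bij_betw f R R1" by (simp add: bij_betw_def)
  moreover have "f (mul a b) = interval_add (f a) (f b)" if "a \<in> R" "b \<in> R" for a b
  proof -
    have "{t \<in> W. \<exists>p\<in>V a. \<exists>q\<in>V b. p + q \<le> t} = {p + q |p q. p \<in> V a \<and> q \<in> V b}" (is "?l = ?r")
    proof safe
      fix t p q assume t: "p \<in> V a" "q \<in> V b" "p + q \<le> t"
      \<comment> \<open>The second summand absorbs the surplus of t over p + q.\<close>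
      then have "t - p \<in> V b" using up(2)[OF that(2), of q "t - p"] by simp
      then show "\<exists>p q. t = p + q \<and> p \<in> V a \<and> q \<in> V b" using t by (intro exI[of _ p] exI[of _ "t - p"]) auto
    next
      fix p q assume pq: "p \<in> V a" "q \<in> V b"
      then have "0 \<le> p" "0 \<le> q" using up(1)[OF that(1)] up(1)[OF that(2)] by auto
      then show "p + q \<in> W" unfolding W by simp
      show "\<exists>p'\<in>V a. \<exists>q'\<in>V b. p' + q' \<le> p + q" using pq by blast
    qed
    then show ?thesis unfolding f_def interval_add_conv V_mul[OF that] by simp
  qed
  moreover have "a \<le> b \<longleftrightarrow> f a \<subseteq> f b" if "a \<in> R" "b \<in> R" for a b
    unfolding f_def insert_inf_subset_iff using V_le that by simp
  ultimately show ?thesis unfolding mlat_iso_def by blast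
qed

text \<open>An upward closed set of naturals is empty or consists of all numbers from its least one
  on. Larger sets have smaller infima, hence the sign; the empty set, the smallest, goes to minus
  infinity.\<close>

lemma mlat_iso_Zminus:
  assumes W: "W = range real"
  shows "mlat_iso R (\<le>) mul Zminus (\<le>) (+)"
proof -
  define f where "f a = (if V a = {} then -\<infinity> else ereal (- Inf (V a)))" for a
  have VR: "V ` R = insert {} (range (\<lambda>n. real ` {n..}))"
  proof -
    have *: "A = {} \<or> (\<exists>n. A = real ` {n..})"
      if A: "A \<subseteq> W" "\<And>p q. \<lbrakk>p \<in> A; q \<in> W; p \<le> q\<rbrakk> \<Longrightarrow> q \<in> A" for A
    proof (cases "A = {}")
      case False
      then have ex: "\<exists>n. real n \<in> A" using A(1) W by blast
      define n where "n = (LEAST n. real n \<in> A)"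
      have n: "real n \<in> A" unfolding n_def using ex by (rule LeastI_ex)
      have least: "n \<le> k" if "real k \<in> A" for k unfolding n_def using that by (rule Least_le)
      have "A = real ` {n..}"
      proof (intro equalityI subsetI)
        fix x assume x: "x \<in> A"
        then obtain k where "x = real k" using A(1) W by blast
        then show "x \<in> real ` {n..}" using least x by simp
      next
        fix x assume "x \<in> real ` {n..}"
        then obtain k where "x = real k" "n \<le> k" by auto
        then show "x \<in> A" using A(2)[OF n, of "real k"] W by simp
      qed
      then show ?thesis by blast
    qed auto
    have **: "real ` {n..} \<in> {A. A \<subseteq> W \<and> (\<forall>p\<in>A. \<forall>q\<in>W. p \<le> q \<longrightarrow> q \<in> A)}" for n
      unfolding W by auto
    show ?thesis unfolding V_image
    proof (intro equalityI subsetI)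
      fix A assume "A \<in> {A. A \<subseteq> W \<and> (\<forall>p\<in>A. \<forall>q\<in>W. p \<le> q \<longrightarrow> q \<in> A)}"
      then show "A \<in> insert {} (range (\<lambda>n. real ` {n..}))" using *[of A] by auto
    next
      fix A assume "A \<in> insert {} (range (\<lambda>n. real ` {n..}))"
      then show "A \<in> {A. A \<subseteq> W \<and> (\<forall>p\<in>A. \<forall>q\<in>W. p \<le> q \<longrightarrow> q \<in> A)}" using ** by (elim insertE rangeE) simp_all
    qed
  qed
  have cases: "V a = {} \<and> f a = -\<infinity> \<or> (\<exists>n. V a = real ` {n..} \<and> f a = ereal (- real n))" if "a \<in> R" for a
  proof -
    have inf: "Inf (real ` {n..}) = real n" for n by (rule cInf_eq_minimum) auto
    have "V a \<in> insert {} (range (\<lambda>n. real ` {n..}))" using imageI[OF that, of V] unfolding VR .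
    then show ?thesis
    proof (elim insertE rangeE)
      fix n assume "V a = real ` {n..}"
      then show ?thesis using inf by (auto simp: f_def)
    qed (simp add: f_def)
  qed
  have sub: "real ` {k..} \<subseteq> real ` {l..} \<longleftrightarrow> l \<le> k" for k l
    by (simp add: inj_image_subset_iff)
  have le: "a \<le> b \<longleftrightarrow> f a \<le> f b" if "a \<in> R" "b \<in> R" for a b
    using cases[OF that(1)] cases[OF that(2)] unfolding V_le[OF that] by (elim disjE conjE exE) (simp_all add: sub)
  have "f ` R = Zminus"
  proof
    show "f ` R \<subseteq> Zminus"
    proof safe
      fix a assume "a \<in> R"
      from cases[OF this] show "f a \<in> Zminus"
        using Zminus_in(2)[of "- int n" for n] Zminus_in(1) by auto
    qed
    show "Zminus \<subseteq> f ` R"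
    proof
      fix x assume "x \<in> Zminus"
      then show "x \<in> f ` R"
      proof (cases rule: Zminus_cases)
        case 1
        have "{} \<in> V ` R" using VR by simp
        then show ?thesis using 1 by (auto simp: f_def image_iff)
      next
        case (2 k)
        have "real ` {nat (- k)..} \<in> V ` R" using VR by simp
        then obtain a where a: "a \<in> R" "V a = real ` {nat (- k)..}" by auto
        moreover have "real ` {nat (- k)..} \<noteq> {}" by simp
        ultimately obtain n where n: "real ` {nat (- k)..} = real ` {n..}" "f a = ereal (- real n)"
          using cases[OF a(1)] unfolding a(2) by blast
        then have "nat (- k) = n" using sub[of n "nat (- k)"] sub[of "nat (- k)" n] by simp
        then have "x = f a" using n 2 by auto
        then show ?thesis using a by blast
      qed
    qed
  qed
  moreover have "inj_on f R" using le by (intro inj_onI antisym) auto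
  ultimately have "bij_betw f R Zminus" by (simp add: bij_betw_def)
  moreover have "f (mul a b) = f a + f b" if ab: "a \<in> R" "b \<in> R" for a b
  proof (cases "V a = {} \<or> V b = {}")
    case True
    then have "V (mul a b) = {}" unfolding V_mul[OF ab] by auto
    then show ?thesis using True cases[OF ab(1)] cases[OF ab(2)] by (auto simp: f_def)
  next
    case False
    then obtain k l where kl: "V a = real ` {k..}" "f a = ereal (- real k)" "V b = real ` {l..}" "f b = ereal (- real l)"
      using cases[OF ab(1)] cases[OF ab(2)] by auto
    have "V (mul a b) = real ` {k + l..}"
    proof (rule set_eqI)
      fix t
      show "t \<in> V (mul a b) \<longleftrightarrow> t \<in> real ` {k + l..}"
      proof
        assume "t \<in> V (mul a b)"
        then obtain n p q where "t = real n" "k \<le> p" "l \<le> q" "real p + real q \<le> real n"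
          unfolding V_mul[OF ab] kl W by auto
        then show "t \<in> real ` {k + l..}" by auto
      next
        assume "t \<in> real ` {k + l..}"
        then have "t \<in> W" "real k + real l \<le> t" unfolding W by auto
        moreover have "real k \<in> V a" "real l \<in> V b" unfolding kl by simp_all
        ultimately show "t \<in> V (mul a b)" unfolding V_mul[OF ab] by blast
      qed
    qed
    moreover have "Inf (real ` {k + l..}) = real (k + l)" by (rule cInf_eq_minimum) (auto simp del: of_nat_add)
    ultimately show ?thesis using kl by (simp add: f_def)
  qed
  ultimately show ?thesis unfolding mlat_iso_def using le by blast
qed

end

section \<open>Localizations of sharp lattices\<close>

context sharp_max
begin

text \<open>An element is recorded by the values of the principal elements below it. Generation by
  principal elements makes this faithful; \<open>j_prime\<close> makes every upward closed set occur
  and brings a principal element below a product under a product of principal elements.\<close>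

lemma local_iso:
  assumes "m \<noteq> bot"
  shows "mlat_iso (loc_carrier mult m) (\<le>) (loc_mult mult m) Zminus (\<le>) (+) \<or>
    mlat_iso (loc_carrier mult m) (\<le>) (loc_mult mult m) R1 (\<subseteq>) interval_add"
proof -
  \<comment> \<open>A principal q below m does not localize to \<open>top\<close>, so the cone is
    nontrivial.\<close>
  obtain q where "q \<in> prin" "q \<le> m" using le_if_prin[of m bot] assms bot_unique by blast
  then have "j q \<in> M" "j q \<noteq> top" using j_top_iff by auto
  then have "M \<noteq> {top}" by blast
  then obtain v :: "'a \<Rightarrow> real" where
    v_add: "\<And>x y. \<lbrakk>x \<in> M; y \<in> M\<rbrakk> \<Longrightarrow> v (loc_mult mult m x y) = v x + v y"
    and v_le: "\<And>x y. \<lbrakk>x \<in> M; y \<in> M\<rbrakk> \<Longrightarrow> v x \<le> v y \<longleftrightarrow> y \<le> x"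
    and v_image: "v ` M = range real \<or> v ` M = {0..}"
    by (rule complete_cone.complete_cone_real[OF M_cone]) blast
  define V where "V a = v ` {x \<in> M. x \<le> a}" for a
  have mem_V: "v (j q) \<in> V a \<longleftrightarrow> j q \<le> a" if "q \<in> prin" for q a
  proof
    assume "v (j q) \<in> V a"
    then obtain y where y: "y \<in> M" "y \<le> a" "v (j q) = v y" unfolding V_def by blast
    then have "j q \<le> y" using v_le[of y "j q"] that by simp
    then show "j q \<le> a" using y(2) by (rule order_trans)
  qed (use that in \<open>auto simp: V_def\<close>)
  have V_elim: "\<exists>q\<in>prin. t = v (j q) \<and> j q \<le> a" if "t \<in> V a" for t a
    using that unfolding V_def by blast
  have VM: "V a \<subseteq> v ` M" for a unfolding V_def by blast
  have "value_sets (range j) (loc_mult mult m) V (v ` M)"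
  proof
    fix a b assume ab: "a \<in> range j" "b \<in> range j"
    then have ja: "j a = a" and jb: "j b = b" by auto
    show "a \<le> b \<longleftrightarrow> V a \<subseteq> V b"
    proof
      assume "a \<le> b"
      then show "V a \<subseteq> V b" unfolding V_def by (blast intro: order_trans)
    next
      assume sub: "V a \<subseteq> V b"
      show "a \<le> b"
      proof (rule le_if_prin)
        fix q assume q: "q \<in> prin" "q \<le> a"
        then have "j q \<le> a" using j_mono[OF q(2)] ja by simp
        then have "j q \<le> b" using mem_V[OF q(1)] sub by blast
        then show "q \<le> b" using j_incr[of q] by (rule order_trans[rotated])
      qed
    qed
    show "V (loc_mult mult m a b) = {t \<in> v ` M. \<exists>p\<in>V a. \<exists>q\<in>V b. p + q \<le> t}"
    proof (intro equalityI subsetI)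
      fix t assume t: "t \<in> V (loc_mult mult m a b)"
      then obtain x where x: "x \<in> prin" "t = v (j x)" "j x \<le> j (a \<odot> b)"
        using V_elim unfolding loc_mult_def by blast
      let ?A = "{g \<odot> h |g h. g \<in> prin \<and> g \<le> a \<and> h \<in> prin \<and> h \<le> b}"
      have "j x \<le> j (Sup ?A)" using x(3) j_mono[OF mult_le_Sup_prin[of a b]] by (rule order_trans)
      then have xA: "x \<le> j (Sup ?A)" by (simp add: j_le_iff)
      have AQ: "?A \<subseteq> prin" using prin_mult by blast
      obtain c where c: "c \<in> ?A" "x \<le> j c" using j_prime[OF x(1) AQ xA] by (rule bexE)
      from c(1) obtain g h where "c = g \<odot> h" and gh: "g \<in> prin" "g \<le> a" "h \<in> prin" "h \<le> b" by blast
      then have xgh: "x \<le> j (g \<odot> h)" using c(2) by simp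
      have "j g \<le> a" "j h \<le> b" using j_mono[of g a] j_mono[of h b] ja jb gh by simp_all
      then have "v (j g) \<in> V a" "v (j h) \<in> V b" using mem_V gh by blast+
      moreover have "v (j g) + v (j h) = v (j (g \<odot> h))"
        using v_add[of "j g" "j h"] gh by (simp add: loc_mult_def j_mult)
      moreover have "v (j (g \<odot> h)) \<le> v (j x)"
        using v_le[of "j (g \<odot> h)" "j x"] gh xgh x(1) prin_mult by (simp add: j_le_iff)
      ultimately have "\<exists>p\<in>V a. \<exists>q\<in>V b. p + q \<le> t" using x(2) by force
      then show "t \<in> {t \<in> v ` M. \<exists>p\<in>V a. \<exists>q\<in>V b. p + q \<le> t}" using t VM by blast
    next
      fix t assume "t \<in> {t \<in> v ` M. \<exists>p\<in>V a. \<exists>q\<in>V b. p + q \<le> t}"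
      then obtain x p q where x: "x \<in> prin" "t = v (j x)" "p \<in> V a" "q \<in> V b" "p + q \<le> t" by blast
      obtain g h where gh: "g \<in> prin" "p = v (j g)" "j g \<le> a" "h \<in> prin" "q = v (j h)" "j h \<le> b"
        using V_elim x(3,4) by blast
      have "v (j (g \<odot> h)) \<le> v (j x)"
        using v_add[of "j g" "j h"] gh x by (simp add: loc_mult_def j_mult)
      then have "j x \<le> j (j g \<odot> j h)"
        using v_le[of "j (g \<odot> h)" "j x"] gh x(1) prin_mult by (simp add: j_mult)
      also have "\<dots> \<le> j (a \<odot> b)" using gh by (intro j_mono mult_mono)
      finally show "t \<in> V (loc_mult mult m a b)"
        using mem_V[OF x(1)] x(2) by (simp add: loc_mult_def)
    qed
  next
    show "V ` range j = {A. A \<subseteq> v ` M \<and> (\<forall>p\<in>A. \<forall>q\<in>v ` M. p \<le> q \<longrightarrow> q \<in> A)}"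
    proof (intro equalityI subsetI)
      fix A assume "A \<in> V ` range j"
      then obtain a where A: "A = V a" by blast
      have "q \<in> A" if pq: "p \<in> A" "q \<in> v ` M" "p \<le> q" for p q
      proof -
        obtain x where x: "x \<in> prin" "p = v (j x)" "j x \<le> a" using V_elim pq(1) A by blast
        obtain y where y: "y \<in> prin" "q = v (j y)" using pq(2) by blast
        have "j y \<le> j x" using v_le[of "j x" "j y"] pq x y by simp
        then show ?thesis using mem_V y A x(3) by (simp add: order_trans)
      qed
      then show "A \<in> {A. A \<subseteq> v ` M \<and> (\<forall>p\<in>A. \<forall>q\<in>v ` M. p \<le> q \<longrightarrow> q \<in> A)}" using VM A by blast
    next
      fix A assume "A \<in> {A. A \<subseteq> v ` M \<and> (\<forall>p\<in>A. \<forall>q\<in>v ` M. p \<le> q \<longrightarrow> q \<in> A)}"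
      then have A: "A \<subseteq> v ` M" "\<And>p q. \<lbrakk>p \<in> A; q \<in> v ` M; p \<le> q\<rbrakk> \<Longrightarrow> q \<in> A" by blast+
      \<comment> \<open>By \<open>j_prime\<close> a principal element locally below the join of B is
        locally below a member of B, so the join gains no value outside A.\<close>
      define B where "B = {q \<in> prin. v (j q) \<in> A}"
      have "V (j (Sup B)) = A"
      proof (intro equalityI subsetI)
        fix t assume "t \<in> V (j (Sup B))"
        then obtain x where x: "x \<in> prin" "t = v (j x)" "j x \<le> j (Sup B)" using V_elim by blast
        moreover have "B \<subseteq> prin" by (auto simp: B_def)
        ultimately obtain q where q: "q \<in> B" "x \<le> j q" using j_prime[OF x(1)] j_le_iff by blast
        then have "v (j q) \<le> v (j x)" using v_le[of "j q" "j x"] x by (simp add: B_def j_le_iff)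
        then show "t \<in> A" using A(2)[of "v (j q)" t] q x by (simp add: B_def)
      next
        fix t assume t: "t \<in> A"
        then obtain q where q: "q \<in> prin" "t = v (j q)" using A(1) by blast
        then have "q \<in> B" using t by (simp add: B_def)
        then have "j q \<le> j (Sup B)" by (intro j_mono Sup_upper)
        then show "t \<in> V (j (Sup B))" using mem_V q by blast
      qed
      then show "A \<in> V ` range j" by blast
    qed
  qed
  then interpret value_sets "range j" "loc_mult mult m" V "v ` M" .
  show ?thesis unfolding loc_carrier_def using v_image mlat_iso_R1 mlat_iso_Zminus by blast
qed

end

section \<open>Independence of localizations and gluing\<close>

context c_lattice_max
begin

lemma loc_mult_closed: "loc_mult mult m x y \<in> loc_carrier mult m"
  unfolding loc_mult_def loc_carrier_def by blast

lemma local_sharp_archimedean: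
  assumes "mlat_iso (loc_carrier mult m) (\<le>) (loc_mult mult m) Zminus (\<le>) (+) \<or>
    mlat_iso (loc_carrier mult m) (\<le>) (loc_mult mult m) R1 (\<subseteq>) interval_add"
  shows "sharp_on (loc_carrier mult m) (\<le>) (loc_mult mult m)"
    and "archimedean_on (loc_carrier mult m) (\<le>) (loc_mult mult m)"
proof -
  note Z = mlat_iso_sharp_archimedean[where mulA = "loc_mult mult m",
      OF _ loc_mult_closed sharp_on_Zminus archimedean_on_Zminus]
  note R = mlat_iso_sharp_archimedean[where mulA = "loc_mult mult m",
      OF _ loc_mult_closed sharp_on_R1 archimedean_on_R1]
  show "sharp_on (loc_carrier mult m) (\<le>) (loc_mult mult m)"
    using assms Z(1) R(1) by blast
  show "archimedean_on (loc_carrier mult m) (\<le>) (loc_mult mult m)"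
    using assms Z(2) R(2) by blast
qed

text \<open>A principal q below m but not below n has a non-idempotent localization at m, so some
  power of it lies below j t. Since n is prime and q is not below n, no such power lies below
  n.\<close>

lemma j_not_le_other:
  assumes arch: "archimedean_on (loc_carrier mult m) (\<le>) (loc_mult mult m)"
    and n: "ml_maximal n" "n \<noteq> m" and t: "t \<noteq> bot"
  shows "\<not> j t \<le> n"
proof
  assume jt: "j t \<le> n"
  interpret n: c_lattice_max mult n using n maximal_locale by blast
  have "\<not> m \<le> n" using max n unfolding ml_maximal_def by blast
  then obtain q where q: "q \<in> prin" "q \<le> m" "\<not> q \<le> n" using le_if_prin by blast
  \<comment> \<open>Idempotence would give q s \<le> q q with s not below m; cancelling q yields s
    \<le> q \<le> m.\<close>
  have "loc_mult mult m (j q) (j q) \<noteq> j q"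
  proof
    assume "loc_mult mult m (j q) (j q) = j q"
    then have "q \<le> j (q \<odot> q)" using j_incr[of q] by (simp add: loc_mult_def j_mult)
    then obtain s where s: "\<not> s \<le> m" "q \<odot> s \<le> q \<odot> q" using compact_le_j[OF prin_compact[OF q(1)]] by blast
    then have "s \<le> q" using prin_cancel[OF q(1), of s q] by (simp add: comm)
    then show False using s(1) q(2) order_trans by blast
  qed
  moreover have "\<not> j t \<le> j bot" using t j_incr[of t] by (auto simp: bot_unique)
  ultimately obtain k where k: "(loc_mult mult m (j q) ^^ k) (j q) \<le> j t"
    using arch unfolding archimedean_on_def loc_carrier_def by blast
  have "\<not> (loc_mult mult m (j q) ^^ k) (j q) \<le> n"
  proof (induction k)
    case 0
    then show ?case using q(3) j_incr[of q] by (auto intro: order_trans)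
  next
    case (Suc k)
    let ?y = "(loc_mult mult m (j q) ^^ k) (j q)"
    have "\<not> j q \<odot> ?y \<le> n" using Suc q(3) j_incr[of q] by (auto simp: n.m_prime intro: order_trans)
    moreover have "j q \<odot> ?y \<le> loc_mult mult m (j q) ?y" by (simp add: loc_mult_def j_incr)
    ultimately show ?case by (auto intro: order_trans)
  qed
  then show False using k jt order_trans by blast
qed

lemma j_Inf_finite: "finite S \<Longrightarrow> j (Inf S) = Inf (j ` S)"
  by (induction rule: finite_induct) (simp_all add: j_inf)

end

context c_lattice_domain
begin

lemma sharp_imp_local_iso:
  assumes sharp: "ml_sharp mult" and ne: "(UNIV :: 'a set) \<noteq> {bot, top}" and m: "ml_maximal m"
  shows "mlat_iso (loc_carrier mult m) (\<le>) (loc_mult mult m) Zminus (\<le>) (+) \<or>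
    mlat_iso (loc_carrier mult m) (\<le>) (loc_mult mult m) R1 (\<subseteq>) interval_add"
proof -
  interpret sharp_max mult m using sharp m by unfold_locales
  \<comment> \<open>If \<open>bot\<close> were maximal, it and \<open>top\<close> would be the only
    elements, the case excluded by \<open>ne\<close>.\<close>
  have "m \<noteq> bot"
  proof
    assume "m = bot"
    then have "x = bot \<or> x = top" for x :: 'a using m unfolding ml_maximal_def by auto
    then show False using ne by blast
  qed
  then show ?thesis by (rule local_iso)
qed

text \<open>For \<open>b \<noteq> 0\<close>, factor \<open>b\<close> locally at the finitely many maximal elements above it and take the
  meets of the local factors. A nonzero element closed at one maximal element becomes \<open>1\<close> when
  localized at another, so these meets have the prescribed localizations.\<close>

lemma local_iso_imp_sharp:
  assumes fin: "ml_finite_character TYPE('a)"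
    and iso: "\<And>m. ml_maximal m \<Longrightarrow>
      mlat_iso (loc_carrier mult m) (\<le>) (loc_mult mult m) Zminus (\<le>) (+) \<or>
      mlat_iso (loc_carrier mult m) (\<le>) (loc_mult mult m) R1 (\<subseteq>) interval_add"
  shows "ml_sharp mult"
  unfolding ml_sharp_def
proof (intro allI impI)
  fix a1 a2 b assume le: "a1 \<odot> a2 \<le> b"
  let ?j = "ml_loc mult"
  show "\<exists>b1 b2. a1 \<le> b1 \<and> a2 \<le> b2 \<and> b = b1 \<odot> b2"
  \<comment> \<open>Finite character concerns nonzero elements. For b = bot the domain property
    makes a1 or a2 equal to \<open>bot\<close>, and bot factors as bot times top.\<close>
  proof (cases "b = bot")
    case True
    then have "a1 = bot \<or> a2 = bot" using le by (simp add: bot_unique mult_eq_bot)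
    then show ?thesis
    proof
      assume "a1 = bot"
      then show ?thesis using True by (intro exI[of _ bot] exI[of _ top]) simp
    next
      assume "a2 = bot"
      then show ?thesis using True by (intro exI[of _ top] exI[of _ bot]) simp
    qed
  next
    case False
    define F where "F = {m. ml_maximal m \<and> b \<le> m}"
    have "finite F" using fin False unfolding ml_finite_character_def F_def by blast
    have "\<exists>c1 c2. a1 \<le> c1 \<and> a2 \<le> c2 \<and> ?j m c1 = c1 \<and> ?j m c2 = c2 \<and> ?j m b = ?j m (c1 \<odot> c2)"
      if "m \<in> F" for m
    proof -
      have m: "ml_maximal m" using that F_def by blast
      interpret c_lattice_max mult m using m maximal_locale by blast
      have "loc_mult mult m (j a1) (j a2) \<le> j b" using j_mono[OF le] by (simp add: loc_mult_def j_mult)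
      then obtain c1 c2 where c: "c1 \<in> range j" "c2 \<in> range j" "j a1 \<le> c1" "j a2 \<le> c2"
        "j b = loc_mult mult m c1 c2"
        using local_sharp_archimedean(1)[OF iso[OF m]] unfolding sharp_on_def loc_carrier_def by blast
      then have "a1 \<le> c1" "a2 \<le> c2" using j_incr order_trans by blast+
      then show ?thesis using c unfolding loc_mult_def by (intro exI[of _ c1] exI[of _ c2]) auto
    qed
    then obtain c1 c2 where c: "\<And>m. m \<in> F \<Longrightarrow> a1 \<le> c1 m" "\<And>m. m \<in> F \<Longrightarrow> a2 \<le> c2 m"
      "\<And>m. m \<in> F \<Longrightarrow> ?j m (c1 m) = c1 m" "\<And>m. m \<in> F \<Longrightarrow> ?j m (c2 m) = c2 m"
      "\<And>m. m \<in> F \<Longrightarrow> ?j m b = ?j m (c1 m \<odot> c2 m)" by metis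
    \<comment> \<open>\<open>j_not_le_other\<close> asks for nonzero elements; a zero factor would
      make the localization of b, which lies above b, equal to \<open>bot\<close>.\<close>
    have nz: "c1 m \<noteq> bot" "c2 m \<noteq> bot" if "m \<in> F" for m
    proof -
      interpret c_lattice_max mult m using that maximal_locale F_def by blast
      have "j b \<noteq> bot" using False j_incr[of b] by (auto simp: bot_unique)
      then show "c1 m \<noteq> bot" "c2 m \<noteq> bot" using c(5)[OF that] by auto
    qed
    have loc: "?j n (Inf (d ` F)) = (if n \<in> F then d n else top)"
      if n: "ml_maximal n" and d: "\<And>m. m \<in> F \<Longrightarrow> ?j m (d m) = d m" "\<And>m. m \<in> F \<Longrightarrow> d m \<noteq> bot" for n d
    proof -
      interpret n: c_lattice_max mult n using n maximal_locale by blast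
      have other: "?j n (d m) = top" if m: "m \<in> F" "m \<noteq> n" for m
      proof -
        have mm: "ml_maximal m" using m F_def by blast
        interpret m: c_lattice_max mult m using mm maximal_locale by blast
        have "\<not> ?j m (d m) \<le> n"
          using m.j_not_le_other[OF m.local_sharp_archimedean(2)[OF iso[OF mm]] n] m d(2) by blast
        then show ?thesis using n.j_top_iff d(1)[OF m(1)] by simp
      qed
      have "?j n (Inf (d ` F)) = Inf ((\<lambda>m. ?j n (d m)) ` F)"
        using n.j_Inf_finite[of "d ` F"] \<open>finite F\<close> by (simp add: image_image)
      also have "\<dots> = (if n \<in> F then d n else top)"
      proof (cases "n \<in> F")
        case True
        have "Inf ((\<lambda>m. ?j n (d m)) ` F) = d n"
        proof (rule antisym)
          show "Inf ((\<lambda>m. ?j n (d m)) ` F) \<le> d n" using True d(1)[OF True] by (metis INF_lower)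
          show "d n \<le> Inf ((\<lambda>m. ?j n (d m)) ` F)"
          proof (rule INF_greatest)
            fix m assume "m \<in> F"
            then show "d n \<le> ?j n (d m)" using other[of m] d(1)[OF True] by (cases "m = n") simp_all
          qed
        qed
        then show ?thesis using True by simp
      next
        case False
        then have "(\<lambda>m. ?j n (d m)) ` F \<subseteq> {top}" using other by auto
        then show ?thesis using False by (simp add: Inf_top_conv subset_iff)
      qed
      finally show ?thesis .
    qed
    \<comment> \<open>For b = top the set F is empty, and the empty meets are \<open>top\<close> as
      required.\<close>
    let ?b1 = "Inf (c1 ` F)" and ?b2 = "Inf (c2 ` F)"
    have eq: "?j n (?b1 \<odot> ?b2) = ?j n b" if n: "ml_maximal n" for n
    proof -
      interpret c_lattice_max mult n using n maximal_locale by blast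
      have l1: "j ?b1 = (if n \<in> F then c1 n else top)" by (rule loc[OF n]) (use c(3) nz(1) in auto)
      have l2: "j ?b2 = (if n \<in> F then c2 n else top)" by (rule loc[OF n]) (use c(4) nz(2) in auto)
      have "j (?b1 \<odot> ?b2) = j (j ?b1 \<odot> j ?b2)" by (simp only: j_mult)
      also have "\<dots> = j b"
      proof (cases "n \<in> F")
        case True
        then show ?thesis unfolding l1 l2 using c(5) by simp
      next
        case False
        then have "j b = top" using n j_top_iff F_def by blast
        then show ?thesis unfolding l1 l2 using False by simp
      qed
      finally show ?thesis .
    qed
    have "b = ?b1 \<odot> ?b2"
    proof (rule antisym; rule le_if_local)
      fix n :: 'a assume n: "ml_maximal n"
      interpret c_lattice_max mult n using n maximal_locale by blast
      show "b \<le> j (?b1 \<odot> ?b2)" unfolding eq[OF n] by (rule j_incr)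
      show "?b1 \<odot> ?b2 \<le> j b" unfolding eq[OF n, symmetric] by (rule j_incr)
    qed
    moreover have "a1 \<le> ?b1" "a2 \<le> ?b2" using c by (auto intro: INF_greatest)
    ultimately show ?thesis by blast
  qed
qed

end

theorem theorem3p12:
  fixes mult :: "'a::complete_lattice \<Rightarrow> 'a \<Rightarrow> 'a"
  assumes "C_lattice mult"
    and "ml_domain mult"
    and "(UNIV :: 'a set) \<noteq> {bot, top}"
    and "\<forall>x. \<exists>S. (\<forall>s\<in>S. ml_principal mult s) \<and> x = Sup S"
    and "ml_finite_character TYPE('a)"
  shows "ml_sharp mult \<longleftrightarrow>
    (\<forall>m. ml_maximal m \<longrightarrow>
       (mlat_iso (loc_carrier mult m) (\<le>) (loc_mult mult m) Zminus (\<le>) (+) \<or>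
        mlat_iso (loc_carrier mult m) (\<le>) (loc_mult mult m) R1 (\<subseteq>) interval_add))"
proof -
  interpret c_lattice_domain mult using assms(1,2,4) by unfold_locales
  show ?thesis using sharp_imp_local_iso local_iso_imp_sharp assms(3,5) by blast
qed

end
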